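(* Let $\sigma\in L^1_\alpha(\mathcal X)$ and $\varphi,\psi\in L^1_\alpha(\mathbb R^{d+1}_+)\cap L^\infty_\alpha(\mathbb R^{d+1}_+)$. Then for all $1\le p\le\infty$ there exists a unique bounded linear operator $\mathcal L_{\varphi,\psi}(\sigma)$ from $L^p_\alpha(\mathbb R^{d+1}_+)$ into itself (given by the defining formula of the two-wavelet localization operator), and $$\|\mathcal L_{\varphi,\psi}(\sigma)\|_{\mathcal B(L^p_\alpha(\mathbb R^{d+1}_+))}\le \max\big(\|\varphi\|_{\alpha,1}\|\psi\|_{\alpha,\infty},\ \|\varphi\|_{\alpha,\infty}\|\psi\|_{\alpha,1}\big)\,\|\sigma\|_{L^1_\alpha(\mathcal X)}.$$
   Context: Fix an integer $d\ge 1$ and a real $\alpha>-1/2$. Let $\mathbb R^{d+1}_+=\mathbb R^d\times(0,\infty)$, with points $x=(x',x_{d+1})$, equipped with the measure $$d\mu_\alpha(x)=\frac{x_{d+1}^{2\alpha+1}}{(2\pi)^d2^{2\alpha}\Gamma^2(\alpha+1)}\,dx.$$ For $1\le p\le\infty$, $L^p_\alpha(\mathbb R^{d+1}_+)$ is the $L^p$ space of complex-valued functions for $\mu_\alpha$, with norm $\|\cdot\|_{\alpha,p}$; $\mathcal B(E)$ denotes the bounded linear operators on a Banach space $E$ and $\|\cdot\|_{\mathcal B(E)}$ the operator norm. Let $\mathcal X=\{(a,x): a>0,\ x\in\mathbb R^{d+1}_+\}$ with measure $d\mu_\alpha(a,x)=\frac{d\mu_\alpha(x)\,da}{a^{2\alpha+d+3}}$,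 and $L^p_\alpha(\mathcal X)$ the corresponding $L^p$ space with norm $\|\cdot\|_{L^p_\alpha(\mathcal X)}$. Generalized translation, for $x,y\in\mathbb R^{d+1}_+$: $$\tau^\alpha_x\varphi(y)=\frac{\Gamma(\alpha+1)}{\sqrt\pi\,\Gamma(\alpha+1/2)}\int_0^\pi\varphi\Big(x'+y',\sqrt{x_{d+1}^2+y_{d+1}^2+2x_{d+1}y_{d+1}\cos\theta}\Big)(\sin\theta)^{2\alpha}\,d\theta;$$ it extends to a contraction on every $L^p_\alpha(\mathbb R^{d+1}_+)$. For $a>0$ put $\varphi_a(x)=a^{-(2\alpha+d+2)}\varphi(x/a)$ and $\varphi_{a,x}(y)=a^{\alpha+1+\frac d2}\,\tau^\alpha_x\varphi_a(y)$. Weinstein continuous wavelet transform (for $f$ and $\varphi$ in Lebesgue spaces with conjugate exponents): $$\Phi^W_\varphi(f)(a,x)=\int_{\mathbb R^{d+1}_+}f(y)\,\overline{\varphi_{a,x}(y)}\,d\mu_\alpha(y),\quad (a,x)\in\mathcal X.$$ Two-wavelet localization operator with symbol $\sigma$ (measurable on $\mathcal X$) and windows $\varphi,\psi$ (measurable on $\mathbb R^{d+1}_+$): $$\mathcal L_{\varphi,\psi}(\sigma)(f)(y)=\int_{\mathcal X}\sigma(a,x)\,\Phi^W_\varphi(f)(a,x)\,\psi_{a,x}(y)\,d\mu_\alpha(a,x),\quad y\in\mathbb R^{d+1}_+.$$ *)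

theory Defs
  imports "HOL-Probability.Essential_Supremum"
begin

section \<open>Complex Lebesgue spaces\<close>

text \<open>
  The exponent ranges over the extended nonnegative reals; only \<open>1 \<le> p \<le> \<infinity>\<close> is used.
  \<open>Lp_fun M p\<close> consists of functions, \<open>Lp M p\<close> of their almost-everywhere classes.
  A function matters only on \<open>space M\<close>, both for measurability and for a.e. equality.
\<close>

definition Lp_fun :: "'a measure \<Rightarrow> ennreal \<Rightarrow> ('a \<Rightarrow> complex) set" where
  "Lp_fun M p = {f \<in> borel_measurable M.
     if p = \<infinity> then esssup M (\<lambda>x. ennreal (cmod (f x))) < \<infinity>
     else integrable M (\<lambda>x. cmod (f x) powr enn2real p)}"

definition Lp_norm :: "'a measure \<Rightarrow> ennreal \<Rightarrow> ('a \<Rightarrow> complex) \<Rightarrow> real" where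
  "Lp_norm M p f =
     (if p = \<infinity> then enn2real (esssup M (\<lambda>x. ennreal (cmod (f x))))
      else (\<integral>x. cmod (f x) powr enn2real p \<partial>M) powr (1 / enn2real p))"

definition ae_class :: "'a measure \<Rightarrow> ('a \<Rightarrow> complex) \<Rightarrow> ('a \<Rightarrow> complex) set" where
  "ae_class M f = {g \<in> borel_measurable M. AE x in M. g x = f x}"

definition Lp :: "'a measure \<Rightarrow> ennreal \<Rightarrow> ('a \<Rightarrow> complex) set set" where
  "Lp M p = ae_class M ` Lp_fun M p"

definition class_add ::
    "'a measure \<Rightarrow> ('a \<Rightarrow> complex) set \<Rightarrow> ('a \<Rightarrow> complex) set \<Rightarrow> ('a \<Rightarrow> complex) set" where
  "class_add M u v =
     {h \<in> borel_measurable M. \<exists>f\<in>u. \<exists>g\<in>v. AE x in M. h x = f x + g x}"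

definition class_scale ::
    "'a measure \<Rightarrow> complex \<Rightarrow> ('a \<Rightarrow> complex) set \<Rightarrow> ('a \<Rightarrow> complex) set" where
  "class_scale M c u = {h \<in> borel_measurable M. \<exists>f\<in>u. AE x in M. h x = c * f x}"

definition class_norm :: "'a measure \<Rightarrow> ennreal \<Rightarrow> ('a \<Rightarrow> complex) set \<Rightarrow> real" where
  "class_norm M p u = Lp_norm M p (SOME f. f \<in> u)"

text \<open>
  Operators are maps on classes, \<open>undefined\<close> outside \<open>Lp M p\<close>, so that equality of
  operators is equality on the space.
\<close>

definition bounded_operators ::
    "'a measure \<Rightarrow> ennreal \<Rightarrow> (('a \<Rightarrow> complex) set \<Rightarrow> ('a \<Rightarrow> complex) set) set" where
  "bounded_operators M p = {T \<in> Lp M p \<rightarrow>\<^sub>E Lp M p.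
     (\<forall>u\<in>Lp M p. \<forall>v\<in>Lp M p. T (class_add M u v) = class_add M (T u) (T v)) \<and>
     (\<forall>c. \<forall>u\<in>Lp M p. T (class_scale M c u) = class_scale M c (T u)) \<and>
     (\<exists>C. \<forall>u\<in>Lp M p. class_norm M p (T u) \<le> C * class_norm M p u)}"

definition operator_norm ::
    "'a measure \<Rightarrow> ennreal \<Rightarrow> (('a \<Rightarrow> complex) set \<Rightarrow> ('a \<Rightarrow> complex) set) \<Rightarrow> real" where
  "operator_norm M p T = Sup {class_norm M p (T u) | u. u \<in> Lp M p \<and> class_norm M p u \<le> 1}"

text \<open>The operations on classes agree with the pointwise ones on representatives.\<close>

lemma ae_class_self: "f \<in> borel_measurable M \<Longrightarrow> f \<in> ae_class M f"
  by (simp add: ae_class_def)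

lemma ae_class_eq_iff:
  assumes "f \<in> borel_measurable M" "g \<in> borel_measurable M"
  shows "ae_class M f = ae_class M g \<longleftrightarrow> (AE x in M. f x = g x)"
proof
  assume "ae_class M f = ae_class M g"
  then show "AE x in M. f x = g x"
    using ae_class_self[OF assms(1)] by (simp add: ae_class_def)
next
  assume fg: "AE x in M. f x = g x"
  have "(AE x in M. h x = f x) \<longleftrightarrow> (AE x in M. h x = g x)" for h
    using fg by (auto elim: AE_mp)
  then show "ae_class M f = ae_class M g" by (simp add: ae_class_def)
qed

lemma class_add_ae_class:
  assumes "f \<in> borel_measurable M" "g \<in> borel_measurable M"
  shows "class_add M (ae_class M f) (ae_class M g) = ae_class M (\<lambda>x. f x + g x)"
proof (rule set_eqI, rule iffI)
  fix h assume "h \<in> class_add M (ae_class M f) (ae_class M g)"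
  then obtain f' g' where h: "h \<in> borel_measurable M" "AE x in M. h x = f' x + g' x"
      "AE x in M. f' x = f x" "AE x in M. g' x = g x"
    by (auto simp: class_add_def ae_class_def)
  from h(2-4) have "AE x in M. h x = f x + g x" by eventually_elim simp
  with h(1) show "h \<in> ae_class M (\<lambda>x. f x + g x)" by (simp add: ae_class_def)
next
  fix h assume "h \<in> ae_class M (\<lambda>x. f x + g x)"
  then show "h \<in> class_add M (ae_class M f) (ae_class M g)"
    using ae_class_self[OF assms(1)] ae_class_self[OF assms(2)]
    by (auto simp: class_add_def ae_class_def[of M "\<lambda>x. f x + g x"])
qed

lemma class_scale_ae_class:
  assumes "f \<in> borel_measurable M"
  shows "class_scale M c (ae_class M f) = ae_class M (\<lambda>x. c * f x)"
proof (rule set_eqI, rule iffI)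
  fix h assume "h \<in> class_scale M c (ae_class M f)"
  then obtain f' where h: "h \<in> borel_measurable M" "AE x in M. h x = c * f' x"
      "AE x in M. f' x = f x"
    by (auto simp: class_scale_def ae_class_def)
  from h(2-3) have "AE x in M. h x = c * f x" by eventually_elim simp
  with h(1) show "h \<in> ae_class M (\<lambda>x. c * f x)" by (simp add: ae_class_def)
next
  fix h assume "h \<in> ae_class M (\<lambda>x. c * f x)"
  then show "h \<in> class_scale M c (ae_class M f)"
    using ae_class_self[OF assms]
    by (auto simp: class_scale_def ae_class_def[of M "\<lambda>x. c * f x"])
qed

lemma Lp_norm_cong_AE:
  assumes [measurable]: "f \<in> borel_measurable M" "g \<in> borel_measurable M"
    and fg: "AE x in M. f x = g x"
  shows "Lp_norm M p f = Lp_norm M p g"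
proof -
  have "esssup M (\<lambda>x. ennreal (cmod (f x))) = esssup M (\<lambda>x. ennreal (cmod (g x)))"
    by (rule esssup_AE_cong) (use fg in \<open>auto elim: AE_mp\<close>)
  moreover have "(\<integral>x. cmod (f x) powr enn2real p \<partial>M) = (\<integral>x. cmod (g x) powr enn2real p \<partial>M)"
    by (rule integral_cong_AE) (use fg in \<open>auto elim: AE_mp\<close>)
  ultimately show ?thesis by (simp add: Lp_norm_def)
qed

lemma class_norm_ae_class:
  assumes "f \<in> borel_measurable M"
  shows "class_norm M p (ae_class M f) = Lp_norm M p f"
proof -
  have "(SOME g. g \<in> ae_class M f) \<in> ae_class M f"
    using ae_class_self[OF assms] by (rule someI[of "\<lambda>g. g \<in> ae_class M f"])
  then show ?thesis
    unfolding class_norm_def by (intro Lp_norm_cong_AE assms) (auto simp: ae_class_def)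
qed


section \<open>Weinstein wavelet transform and localization operators\<close>

text \<open>
  A point \<open>(x', x\<^sub>d\<^sub>+\<^sub>1)\<close> of \<open>\<real>\<^sup>d\<^sup>+\<^sup>1\<close> is a pair in \<open>(real ^ 'd) \<times> real\<close>, where \<open>d = CARD('d) \<ge> 1\<close>.
\<close>

definition half_space :: "((real ^ 'd) \<times> real) set" where
  "half_space = {x. 0 < snd x}"

definition weinstein_measure :: "real \<Rightarrow> ((real ^ 'd) \<times> real) measure" where
  "weinstein_measure \<alpha> =
     density (restrict_space lborel half_space)
       (\<lambda>x. ennreal (snd x powr (2 * \<alpha> + 1) /
              ((2 * pi) ^ CARD('d) * 2 powr (2 * \<alpha>) * (Gamma (\<alpha> + 1))\<^sup>2)))"

text \<open>The measure on \<open>\<X> = (0,\<infinity>) \<times> \<real>\<^sup>d\<^sup>+\<^sup>1\<^sub>+\<close>; its underlying space is \<open>{0<..} \<times> half_space\<close>.\<close>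

definition scale_measure_X :: "real \<Rightarrow> (real \<times> ((real ^ 'd) \<times> real)) measure" where
  "scale_measure_X \<alpha> =
     density (restrict_space lborel {0<..} \<Otimes>\<^sub>M weinstein_measure \<alpha>)
       (\<lambda>(a, x). ennreal (1 / a powr (2 * \<alpha> + real CARD('d) + 3)))"

text \<open>
  The interval integral below is over the open interval \<open>(0,\<pi>)\<close>, on which the
  argument of \<open>\<phi>\<close> stays in the half-space and \<open>sin \<theta> > 0\<close>.
\<close>

definition translation ::
    "real \<Rightarrow> ((real ^ 'd) \<times> real) \<Rightarrow> (((real ^ 'd) \<times> real) \<Rightarrow> complex) \<Rightarrow> ((real ^ 'd) \<times> real) \<Rightarrow> complex" where
  "translation \<alpha> x \<phi> y =
     complex_of_real (Gamma (\<alpha> + 1) / (sqrt pi * Gamma (\<alpha> + 1 / 2))) *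
     (LBINT \<theta>=0..pi.
        \<phi> (fst x + fst y,
            sqrt ((snd x)\<^sup>2 + (snd y)\<^sup>2 + 2 * snd x * snd y * cos \<theta>)) *
        complex_of_real (sin \<theta> powr (2 * \<alpha>)))"

definition dilation ::
    "real \<Rightarrow> real \<Rightarrow> (((real ^ 'd) \<times> real) \<Rightarrow> complex) \<Rightarrow> ((real ^ 'd) \<times> real) \<Rightarrow> complex" where
  "dilation \<alpha> a \<phi> x =
     complex_of_real (a powr (- (2 * \<alpha> + real CARD('d) + 2))) * \<phi> (x /\<^sub>R a)"

definition wavelet ::
    "real \<Rightarrow> (((real ^ 'd) \<times> real) \<Rightarrow> complex) \<Rightarrow> real \<Rightarrow> ((real ^ 'd) \<times> real) \<Rightarrow> ((real ^ 'd) \<times> real) \<Rightarrow> complex" where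
  "wavelet \<alpha> \<phi> a x y =
     complex_of_real (a powr (\<alpha> + 1 + real CARD('d) / 2)) * translation \<alpha> x (dilation \<alpha> a \<phi>) y"

definition wavelet_transform ::
    "real \<Rightarrow> (((real ^ 'd) \<times> real) \<Rightarrow> complex) \<Rightarrow> (((real ^ 'd) \<times> real) \<Rightarrow> complex) \<Rightarrow>
     real \<times> ((real ^ 'd) \<times> real) \<Rightarrow> complex" where
  "wavelet_transform \<alpha> \<phi> f =
     (\<lambda>(a, x). \<integral>y. f y * cnj (wavelet \<alpha> \<phi> a x y) \<partial>weinstein_measure \<alpha>)"

definition localization_integrand ::
    "real \<Rightarrow> (((real ^ 'd) \<times> real) \<Rightarrow> complex) \<Rightarrow> (((real ^ 'd) \<times> real) \<Rightarrow> complex) \<Rightarrow>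
     (real \<times> ((real ^ 'd) \<times> real) \<Rightarrow> complex) \<Rightarrow> (((real ^ 'd) \<times> real) \<Rightarrow> complex) \<Rightarrow>
     ((real ^ 'd) \<times> real) \<Rightarrow> real \<times> ((real ^ 'd) \<times> real) \<Rightarrow> complex" where
  "localization_integrand \<alpha> \<phi> \<psi> \<sigma> f y =
     (\<lambda>(a, x). \<sigma> (a, x) * wavelet_transform \<alpha> \<phi> f (a, x) * wavelet \<alpha> \<psi> a x y)"

definition localization ::
    "real \<Rightarrow> (((real ^ 'd) \<times> real) \<Rightarrow> complex) \<Rightarrow> (((real ^ 'd) \<times> real) \<Rightarrow> complex) \<Rightarrow>
     (real \<times> ((real ^ 'd) \<times> real) \<Rightarrow> complex) \<Rightarrow> (((real ^ 'd) \<times> real) \<Rightarrow> complex) \<Rightarrow>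
     ((real ^ 'd) \<times> real) \<Rightarrow> complex" where
  "localization \<alpha> \<phi> \<psi> \<sigma> f y =
     (\<integral>z. localization_integrand \<alpha> \<phi> \<psi> \<sigma> f y z \<partial>scale_measure_X \<alpha>)"

text \<open>
  \<open>T\<close> is given by the defining formula on \<open>L\<^sup>p\<close>. Bochner integrals of non-integrable functions
  are \<open>0\<close> by convention, so the absolute convergence of the integrals in the formula is
  required explicitly.
\<close>

definition given_by_localization ::
    "real \<Rightarrow> ennreal \<Rightarrow> (((real ^ 'd) \<times> real) \<Rightarrow> complex) \<Rightarrow> (((real ^ 'd) \<times> real) \<Rightarrow> complex) \<Rightarrow>
     (real \<times> ((real ^ 'd) \<times> real) \<Rightarrow> complex) \<Rightarrow>
     ((((real ^ 'd) \<times> real) \<Rightarrow> complex) set \<Rightarrow> (((real ^ 'd) \<times> real) \<Rightarrow> complex) set) \<Rightarrow> bool" where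
  "given_by_localization \<alpha> p \<phi> \<psi> \<sigma> T \<longleftrightarrow>
     (\<forall>f \<in> Lp_fun (weinstein_measure \<alpha>) p.
        (\<forall>a>0. \<forall>x\<in>half_space.
           integrable (weinstein_measure \<alpha>) (\<lambda>y. f y * cnj (wavelet \<alpha> \<phi> a x y))) \<and>
        (AE y in weinstein_measure \<alpha>.
           integrable (scale_measure_X \<alpha>) (localization_integrand \<alpha> \<phi> \<psi> \<sigma> f y)) \<and>
        T (ae_class (weinstein_measure \<alpha>) f) =
          ae_class (weinstein_measure \<alpha>) (localization \<alpha> \<phi> \<psi> \<sigma> f))"

end

theory Submission
  imports Defs
begin

text \<open>
  The operator is the integral operator with kernel
  \<open>K(y,w) = \<integral> \<sigma>(a,x) \<psi>\<^sub>a\<^sub>,\<^sub>x(y) cnj (\<phi>\<^sub>a\<^sub>,\<^sub>x(w)) d\<mu>(a,x)\<close>, a superposition of rank-one kernels.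
  For each single \<open>(a,x)\<close> the translation is a contraction on \<open>L\<^sup>1\<close> and on \<open>L\<^sup>\<infinity>\<close>, and with
  \<open>\<kappa> = \<alpha> + 1 + d/2\<close> the dilation and the normalising factor give
  \<open>\<parallel>\<phi>\<^sub>a\<^sub>,\<^sub>x\<parallel>\<^sub>1 \<le> a\<^sup>\<kappa> \<parallel>\<phi>\<parallel>\<^sub>1\<close> and \<open>\<parallel>\<psi>\<^sub>a\<^sub>,\<^sub>x\<parallel>\<^sub>\<infinity> \<le> a\<^sup>-\<^sup>\<kappa> \<parallel>\<psi>\<parallel>\<^sub>\<infinity>\<close>. The powers of \<open>a\<close> cancel in the product
  (\<open>wavelet_pair_bound\<close>), so after integrating against \<open>|\<sigma>|\<close> both marginals of the
  kernel \<open>k(y,w) = \<integral> |\<sigma>(a,x)| |\<psi>\<^sub>a\<^sub>,\<^sub>x(y)| |\<phi>\<^sub>a\<^sub>,\<^sub>x(w)| d\<mu>(a,x)\<close> are at most \<open>P \<parallel>\<sigma>\<parallel>\<^sub>1\<close>, where \<open>P\<close> is the maximum in the theorem. Schur's test (\<open>schur_test\<close>)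
  then bounds the operator on every \<open>L\<^sup>p\<close> at once, the endpoints included, and the
  finiteness of \<open>\<integral> k(y,w) |f(w)| dw\<close> for almost every \<open>y\<close> is the absolute convergence of the
  defining integral.

  The contraction property of the translation rests on the identity
  \<open>\<integral> \<tau>\<^sub>x g d\<mu> = \<integral> g d\<mu>\<close> for \<open>g \<ge> 0\<close> (\<open>nn_integral_nn_translation\<close>). In the first \<open>d\<close> variables
  \<open>\<tau>\<^sub>x\<close> is an ordinary shift. In the last one the law of cosines explains the identity: read
  \<open>(y\<^sub>d\<^sub>+\<^sub>1, \<theta>)\<close> as polar coordinates \<open>(s, \<theta>)\<close> of a point \<open>(u,v)\<close> in the upper half plane. Then
  \<open>s\<^sup>2\<^sup>\<alpha>\<^sup>+\<^sup>1 (sin \<theta>)\<^sup>2\<^sup>\<alpha> ds d\<theta> = v\<^sup>2\<^sup>\<alpha> du dv\<close>, and \<open>\<tau>\<^sub>x\<close> evaluates a radial function at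
  \<open>(u + x\<^sub>d\<^sub>+\<^sub>1, v)\<close>, so the identity is the invariance of \<open>v\<^sup>2\<^sup>\<alpha> du dv\<close> under horizontal shifts.
  Applied to the indicator of a null set it shows that translates of functions equal almost
  everywhere are equal almost everywhere, which gives the \<open>L\<^sup>\<infinity>\<close> bound.
\<close>


section \<open>Polar coordinates in the upper half plane\<close>

text \<open>
  Writing the angle as \<open>\<pi>/2 + arctan t\<close> replaces the interval \<open>(0,\<pi>)\<close> by the whole line. The
  substitution rule for compact intervals is applied on \<open>[-n,n]\<close>, and \<open>n\<close> tends to infinity.
\<close>

lemma nn_integral_angle_arctan:
  fixes f :: "real \<Rightarrow> ennreal"
  assumes [measurable]: "f \<in> borel_measurable borel"
  shows "(\<integral>\<^sup>+\<theta>\<in>{0<..<pi}. f \<theta> \<partial>lborel) =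
         (\<integral>\<^sup>+t. f (pi / 2 + arctan t) * ennreal (1 / (1 + t\<^sup>2)) \<partial>lborel)"
proof -
  define g where "g t = pi / 2 + arctan t" for t
  define A where "A n = {g (- real (Suc n))..g (real (Suc n))}" for n
  define B where "B n = {- real (Suc n)..real (Suc n)}" for n
  have g_mono: "g s \<le> g t \<longleftrightarrow> s \<le> t" for s t by (simp add: g_def arctan_le_iff)
  have g_less: "g s < g t \<longleftrightarrow> s < t" for s t by (simp add: g_def arctan_less_iff)
  have subst: "(\<integral>\<^sup>+\<theta>. f \<theta> * indicator (A n) \<theta> \<partial>lborel) =
      (\<integral>\<^sup>+t. f (g t) * ennreal (1 / (1 + t\<^sup>2)) * indicator (B n) t \<partial>lborel)" for n
    unfolding A_def B_def
  proof (rule nn_integral_substitution_aux)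
    show "(g has_real_derivative 1 / (1 + t\<^sup>2)) (at t)" for t
      unfolding g_def[abs_def] using DERIV_add[OF DERIV_const[of "pi/2"] DERIV_arctan[of t]]
      by (simp add: inverse_eq_divide)
    show "continuous_on {- real (Suc n)..real (Suc n)} (\<lambda>t. 1 / (1 + t\<^sup>2))"
      by (intro continuous_intros) (auto simp: add_nonneg_eq_0_iff)
  qed (auto simp: assms)
  have "incseq A" "incseq B"
    by (auto simp: A_def B_def incseq_def) (smt (verit) g_mono of_nat_mono)+
  have "(\<Union>n. B n) = UNIV"
  proof (intro set_eqI iffI UNIV_I)
    fix t :: real
    obtain n where "\<bar>t\<bar> < real n" using reals_Archimedean2 by blast
    then show "t \<in> (\<Union>n. B n)" by (auto simp: B_def intro!: exI[of _ n])
  qed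
  have "(\<Union>n. A n) = {0<..<pi}"
  proof (intro set_eqI iffI)
    fix \<theta> assume "\<theta> \<in> (\<Union>n. A n)"
    then obtain n where "g (- real (Suc n)) \<le> \<theta>" "\<theta> \<le> g (real (Suc n))" by (auto simp: A_def)
    moreover have "0 < g t" "g t < pi" for t
      using arctan_bounded[of t] by (auto simp: g_def)
    ultimately show "\<theta> \<in> {0<..<pi}" by (auto intro: less_le_trans le_less_trans)
  next
    fix \<theta> assume "\<theta> \<in> {0<..<pi}"
    then have \<theta>: "\<theta> = g (tan (\<theta> - pi / 2))"
      by (simp add: g_def arctan_tan)
    have "tan (\<theta> - pi / 2) \<in> (\<Union>n. B n)" using \<open>(\<Union>n. B n) = UNIV\<close> by simp
    then obtain n where "tan (\<theta> - pi / 2) \<in> B n" by blast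
    then have "g (tan (\<theta> - pi / 2)) \<in> A n" by (simp add: A_def B_def g_mono)
    then show "\<theta> \<in> (\<Union>n. A n)" using \<theta> by auto
  qed
  define F where "F t = f (g t) * ennreal (1 / (1 + t\<^sup>2))" for t
  have [measurable]: "g \<in> borel_measurable borel" unfolding g_def by measurable
  have [measurable]: "F \<in> borel_measurable borel" unfolding F_def by measurable
  have "(\<integral>\<^sup>+\<theta>\<in>{0<..<pi}. f \<theta> \<partial>lborel) = emeasure (density lborel f) (\<Union>n. A n)"
    by (simp add: \<open>(\<Union>n. A n) = _\<close> emeasure_density)
  also have "\<dots> = (SUP n. emeasure (density lborel f) (A n))"
    by (rule SUP_emeasure_incseq[symmetric]) (use \<open>incseq A\<close> in \<open>simp_all add: A_def[abs_def] image_subset_iff\<close>)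
  also have "\<dots> = (SUP n. emeasure (density lborel F) (B n))"
    using subst by (simp add: emeasure_density F_def A_def B_def)
  also have "\<dots> = emeasure (density lborel F) (\<Union>n. B n)"
    by (rule SUP_emeasure_incseq) (use \<open>incseq B\<close> in \<open>simp_all add: B_def[abs_def] image_subset_iff\<close>)
  finally show ?thesis
    by (simp add: \<open>(\<Union>n. B n) = _\<close> emeasure_density F_def g_def)
qed

text \<open>
  Polar coordinates by one-dimensional changes of variables only: put \<open>u = -v t\<close> for fixed \<open>v\<close>,
  exchange the integrals, put \<open>v = s / sqrt (1 + t\<^sup>2)\<close> for fixed \<open>t\<close>, exchange again, and
  finally \<open>t = - cot \<theta>\<close>.
\<close>

lemma nn_integral_polar_half_plane:
  fixes H :: "real \<Rightarrow> real \<Rightarrow> ennreal"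
  assumes H: "(\<lambda>(u, v). H u v) \<in> borel_measurable (borel \<Otimes>\<^sub>M borel)"
  shows "(\<integral>\<^sup>+v\<in>{0<..}. (\<integral>\<^sup>+u. H u v \<partial>lborel) \<partial>lborel) =
         (\<integral>\<^sup>+s\<in>{0<..}. (\<integral>\<^sup>+\<theta>\<in>{0<..<pi}. H (s * cos \<theta>) (s * sin \<theta>) \<partial>lborel) * ennreal s \<partial>lborel)"
proof -
  have [measurable (raw)]: "(\<lambda>x. H (a x) (b x)) \<in> borel_measurable M"
    if "a \<in> borel_measurable M" "b \<in> borel_measurable M" for M :: "'x measure" and a b
    using measurable_compose[OF measurable_Pair[OF that] H] by simp
  have "(\<integral>\<^sup>+v\<in>{0<..}. (\<integral>\<^sup>+u. H u v \<partial>lborel) \<partial>lborel) =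
        (\<integral>\<^sup>+v\<in>{0<..}. (\<integral>\<^sup>+t. H (- v * t) v * ennreal v \<partial>lborel) \<partial>lborel)"
  proof (rule nn_integral_cong, simp split: split_indicator, intro impI)
    fix v :: real assume "v > 0"
    have "(\<integral>\<^sup>+u. H u v \<partial>lborel) = ennreal \<bar>- v\<bar> * (\<integral>\<^sup>+t. H (0 + (- v) * t) v \<partial>lborel)"
      using \<open>v > 0\<close> by (intro nn_integral_real_affine) auto
    then show "(\<integral>\<^sup>+u. H u v \<partial>lborel) = (\<integral>\<^sup>+t. H (- (v * t)) v * ennreal v \<partial>lborel)"
      using \<open>v > 0\<close> by (simp add: nn_integral_cmult[symmetric] mult.commute)
  qed
  also have "\<dots> = (\<integral>\<^sup>+v. (\<integral>\<^sup>+t. H (- v * t) v * ennreal v * indicator {0<..} v \<partial>lborel) \<partial>lborel)"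
    by (simp add: nn_integral_multc)
  also have "\<dots> = (\<integral>\<^sup>+t. (\<integral>\<^sup>+v. H (- v * t) v * ennreal v * indicator {0<..} v \<partial>lborel) \<partial>lborel)"
    by (rule lborel_pair.Fubini') measurable
  also have "\<dots> = (\<integral>\<^sup>+t. (\<integral>\<^sup>+s. H (s * cos (pi / 2 + arctan t)) (s * sin (pi / 2 + arctan t))
                     * ennreal (1 / (1 + t\<^sup>2)) * ennreal s * indicator {0<..} s \<partial>lborel) \<partial>lborel)"
  proof (rule nn_integral_cong)
    fix t :: real
    define c where "c = 1 / sqrt (1 + t\<^sup>2)"
    have "c > 0" by (simp add: c_def add_pos_nonneg)
    have c2: "c * c = 1 / (1 + t\<^sup>2)" by (simp add: c_def)
    have sc: "cos (pi / 2 + arctan t) = - (c * t)" "sin (pi / 2 + arctan t) = c"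
      by (simp_all add: cos_add sin_add sin_arctan cos_arctan c_def)
    have "(\<integral>\<^sup>+v. H (- v * t) v * ennreal v * indicator {0<..} v \<partial>lborel) =
          (\<integral>\<^sup>+s. ennreal c * (H (- (c * s) * t) (c * s) * ennreal (c * s) * indicator {0<..} (c * s)) \<partial>lborel)"
      using \<open>c > 0\<close>
      by (subst nn_integral_real_affine[where c = c and t = 0]) (auto simp: nn_integral_cmult)
    also have "\<dots> = (\<integral>\<^sup>+s. H (s * cos (pi / 2 + arctan t)) (s * sin (pi / 2 + arctan t))
                     * ennreal (1 / (1 + t\<^sup>2)) * ennreal s * indicator {0<..} s \<partial>lborel)"
      using \<open>c > 0\<close>
      by (intro nn_integral_cong)
         (auto simp: sc c2[symmetric] ennreal_mult mult_ac zero_less_mult_iff split: split_indicator)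
    finally show "(\<integral>\<^sup>+v. H (- v * t) v * ennreal v * indicator {0<..} v \<partial>lborel) = \<dots>" .
  qed
  also have "\<dots> = (\<integral>\<^sup>+s. (\<integral>\<^sup>+t. H (s * cos (pi / 2 + arctan t)) (s * sin (pi / 2 + arctan t))
                     * ennreal (1 / (1 + t\<^sup>2)) * ennreal s * indicator {0<..} s \<partial>lborel) \<partial>lborel)"
    by (rule lborel_pair.Fubini') measurable
  also have "\<dots> = (\<integral>\<^sup>+s\<in>{0<..}. (\<integral>\<^sup>+\<theta>\<in>{0<..<pi}. H (s * cos \<theta>) (s * sin \<theta>) \<partial>lborel) * ennreal s \<partial>lborel)"
    by (simp add: nn_integral_angle_arctan nn_integral_multc)
  finally show ?thesis .
qed

text \<open>
  On \<open>(0, \<pi>/2)\<close> the substitution \<open>u = (sin \<theta>)\<^sup>2\<close> turns half of the integral into half of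
  \<open>Beta (\<alpha> + 1/2) (1/2)\<close>; reflection at \<open>\<pi>/2\<close> supplies the other half.
\<close>

lemma nn_integral_sin_powr:
  fixes \<alpha> :: real
  assumes "\<alpha> > - 1 / 2"
  shows "(\<integral>\<^sup>+\<theta>\<in>{0<..<pi}. ennreal (sin \<theta> powr (2 * \<alpha>)) \<partial>lborel) =
         ennreal (sqrt pi * Gamma (\<alpha> + 1 / 2) / Gamma (\<alpha> + 1))"
proof -
  define b where "b u = u powr (\<alpha> - 1 / 2) * (1 - u) powr (- 1 / 2)" for u :: real
  define S where "S = (\<lambda>\<theta>. ennreal (sin \<theta> powr (2 * \<alpha>)))"
  have [measurable]: "S \<in> borel_measurable borel" "b \<in> borel_measurable borel"
    unfolding S_def b_def by measurable
  have "(b has_integral Beta (\<alpha> + 1 / 2) (1 / 2)) {0..1}"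
    using has_integral_Beta_real[of "\<alpha> + 1/2" "1/2"] assms by (simp add: b_def[abs_def])
  then have "(\<integral>\<^sup>+u. ennreal (b u) * indicator {0..1} u \<partial>lborel) = ennreal (Beta (\<alpha> + 1 / 2) (1 / 2))"
    by (intro nn_integral_has_integral_lebesgue') (simp add: b_def)
  then have "ennreal (Beta (\<alpha> + 1 / 2) (1 / 2)) = (\<integral>\<^sup>+u. ennreal (b u) * indicator {0..1} u \<partial>lborel)" ..
  also have "\<dots> =
      (\<integral>\<^sup>+u. ennreal (b u) * indicator {(sin 0)\<^sup>2..(sin (pi/2))\<^sup>2} u \<partial>lborel)" by simp
  also have "\<dots> = (\<integral>\<^sup>+\<theta>. ennreal (b ((sin \<theta>)\<^sup>2)) * ennreal (2 * sin \<theta> * cos \<theta>) * indicator {0..pi/2} \<theta> \<partial>lborel)"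
    by (rule nn_integral_substitution_aux)
       (auto intro!: derivative_eq_intros continuous_intros mult_nonneg_nonneg sin_ge_zero cos_ge_zero)
  \<comment> \<open>At \<open>\<theta> = \<pi>/2\<close> the weight \<open>(1 - u)\<^sup>-\<^sup>1\<^sup>/\<^sup>2\<close> is \<open>0\<close> by convention, so the integrands agree only a.e.\<close>
  also have "\<dots> = (\<integral>\<^sup>+\<theta>. 2 * (S \<theta> * indicator {0<..<pi/2} \<theta>) \<partial>lborel)"
  proof (rule nn_integral_cong_AE)
    have "AE \<theta> in lborel. \<theta> \<noteq> (0::real)" "AE \<theta> in lborel. \<theta> \<noteq> pi/2"
      by (rule AE_lborel_singleton)+
    then show "AE \<theta> in lborel. ennreal (b ((sin \<theta>)\<^sup>2)) * ennreal (2 * sin \<theta> * cos \<theta>) * indicator {0..pi/2} \<theta>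
        = 2 * (S \<theta> * indicator {0<..<pi/2} \<theta>)"
    proof eventually_elim
      case (elim \<theta>)
      show ?case
      proof (cases "0 < \<theta> \<and> \<theta> < pi / 2")
        case True
        then have s: "sin \<theta> > 0" and c: "cos \<theta> > 0" by (auto intro: sin_gt_zero cos_gt_zero)
        have "((sin \<theta>)\<^sup>2) powr (\<alpha> - 1/2) = sin \<theta> powr (2 * \<alpha> - 1)"
        proof -
          have "((sin \<theta>)\<^sup>2) powr (\<alpha> - 1/2) = (sin \<theta> powr 2) powr (\<alpha> - 1/2)" using s by simp
          also have "\<dots> = sin \<theta> powr (2 * \<alpha> - 1)"
            unfolding powr_powr by (simp add: algebra_simps)
          finally show ?thesis .
        qed
        moreover have "(1 - (sin \<theta>)\<^sup>2) powr (- 1/2) = inverse (cos \<theta>)"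
        proof -
          have "1 - (sin \<theta>)\<^sup>2 = cos \<theta> powr 2" using c by (simp add: cos_squared_eq)
          then have "(1 - (sin \<theta>)\<^sup>2) powr (- 1/2) = cos \<theta> powr (- 1)"
            by (simp only: powr_powr) simp
          then show ?thesis using c by (simp add: powr_minus)
        qed
        moreover have "sin \<theta> powr (2 * \<alpha>) = sin \<theta> powr (2 * \<alpha> - 1) * sin \<theta>"
          using s by (simp add: powr_diff)
        ultimately have "b ((sin \<theta>)\<^sup>2) * (2 * sin \<theta> * cos \<theta>) = 2 * sin \<theta> powr (2 * \<alpha>)"
          using c by (simp add: b_def field_simps)
        then show ?thesis
          using True s c by (simp add: S_def ennreal_mult'[symmetric] b_def flip: ennreal_numeral)
      qed (use elim in auto)
    qed
  qed
  also have "\<dots> = 2 * (\<integral>\<^sup>+\<theta>\<in>{0<..<pi/2}. S \<theta> \<partial>lborel)" by (simp add: nn_integral_cmult)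
  also have "\<dots> = (\<integral>\<^sup>+\<theta>\<in>{0<..<pi/2}. S \<theta> \<partial>lborel) + (\<integral>\<^sup>+\<theta>\<in>{pi/2<..<pi}. S \<theta> \<partial>lborel)"
  proof -
    have "(\<integral>\<^sup>+\<theta>\<in>{pi/2<..<pi}. S \<theta> \<partial>lborel) = (\<integral>\<^sup>+\<theta>\<in>{0<..<pi/2}. S \<theta> \<partial>lborel)"
      by (subst nn_integral_real_affine[where c = "-1" and t = pi])
         (auto intro!: nn_integral_cong simp: S_def split: split_indicator)
    then show ?thesis by (simp add: mult_2)
  qed
  also have "\<dots> = (\<integral>\<^sup>+\<theta>. S \<theta> * indicator {0<..<pi/2} \<theta> + S \<theta> * indicator {pi/2<..<pi} \<theta> \<partial>lborel)"
    by (subst nn_integral_add) auto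
  also have "\<dots> = (\<integral>\<^sup>+\<theta>\<in>{0<..<pi}. S \<theta> \<partial>lborel)"
    by (rule nn_integral_cong_AE, use AE_lborel_singleton[of "pi/2"] in eventually_elim)
       (auto split: split_indicator)
  finally show ?thesis
    by (simp add: S_def Beta_def Gamma_one_half_real mult.commute add.commute)
qed


section \<open>The Weinstein measure and the generalized translation\<close>

text \<open>
  The points of the half-space carry the Borel sets of the product topology, while the
  projections are known to be measurable for the product of the Borel sigma-algebras. This rule
  and the next one bridge the two, which agree for second countable factors.
\<close>

lemma borel_measurable_fst_comp [measurable (raw)]:
  fixes f :: "'x \<Rightarrow> 'b::second_countable_topology \<times> 'c::second_countable_topology"
  assumes "f \<in> borel_measurable M"
  shows "(\<lambda>x. fst (f x)) \<in> borel_measurable M"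
  using assms by (simp add: borel_prod[symmetric])

lemma borel_measurable_snd_comp [measurable (raw)]:
  fixes f :: "'x \<Rightarrow> 'b::second_countable_topology \<times> 'c::second_countable_topology"
  assumes "f \<in> borel_measurable M"
  shows "(\<lambda>x. snd (f x)) \<in> borel_measurable M"
  using assms by (simp add: borel_prod[symmetric])

lemma half_space_borel [measurable]: "(half_space :: ((real ^ 'd) \<times> real) set) \<in> sets borel"
proof -
  have "open (half_space :: ((real ^ 'd) \<times> real) set)"
    unfolding half_space_def by (intro open_Collect_less continuous_intros)
  then show ?thesis by simp
qed

lemma space_weinstein_measure [simp]: "space (weinstein_measure \<alpha>) = half_space"
  by (simp add: weinstein_measure_def space_restrict_space)

lemma sets_weinstein_measure: "sets (weinstein_measure \<alpha>) = sets (restrict_space borel half_space)"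
  by (simp add: weinstein_measure_def sets_restrict_space)

lemma borel_measurable_weinsteinI:
  "f \<in> borel_measurable borel \<Longrightarrow> f \<in> borel_measurable (weinstein_measure \<alpha>)"
  by (simp add: measurable_cong_sets[OF sets_weinstein_measure refl] measurable_restrict_space1)

definition weinstein_density :: "real \<Rightarrow> ((real ^ 'd) \<times> real) \<Rightarrow> ennreal" where
  "weinstein_density \<alpha> = (\<lambda>x. ennreal (snd x powr (2 * \<alpha> + 1) /
              ((2 * pi) ^ CARD('d) * 2 powr (2 * \<alpha>) * (Gamma (\<alpha> + 1))\<^sup>2)))"

lemma borel_measurable_weinstein_density [measurable]:
  "weinstein_density \<alpha> \<in> borel_measurable borel"
  unfolding weinstein_density_def by measurable

lemma nn_integral_weinstein:
  fixes g :: "((real ^ 'd) \<times> real) \<Rightarrow> ennreal"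
  assumes [measurable]: "g \<in> borel_measurable borel"
  shows "(\<integral>\<^sup>+y. g y \<partial>weinstein_measure \<alpha>) = (\<integral>\<^sup>+y\<in>half_space. weinstein_density \<alpha> y * g y \<partial>lborel)"
proof -
  have "(\<integral>\<^sup>+y. g y \<partial>weinstein_measure \<alpha>) =
      (\<integral>\<^sup>+y. weinstein_density \<alpha> y * g y \<partial>restrict_space lborel half_space)"
    unfolding weinstein_measure_def weinstein_density_def[symmetric]
    by (rule nn_integral_density) (auto intro!: measurable_restrict_space1)
  also have "\<dots> = (\<integral>\<^sup>+y\<in>half_space. weinstein_density \<alpha> y * g y \<partial>lborel)"
    by (rule nn_integral_restrict_space) simp
  finally show ?thesis .
qed

lemma nn_integral_weinstein_iterated:
  fixes g :: "((real ^ 'd) \<times> real) \<Rightarrow> ennreal"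
  assumes [measurable]: "g \<in> borel_measurable borel"
  shows "(\<integral>\<^sup>+y. g y \<partial>weinstein_measure \<alpha>) =
    ennreal (1 / ((2 * pi) ^ CARD('d) * 2 powr (2 * \<alpha>) * (Gamma (\<alpha> + 1))\<^sup>2)) *
    (\<integral>\<^sup>+s\<in>{0<..}. (\<integral>\<^sup>+y'. g (y', s) \<partial>lborel) * ennreal (s powr (2 * \<alpha> + 1)) \<partial>lborel)"
    (is "_ = ennreal ?k * _")
proof -
  have [measurable]: "g \<in> borel_measurable (lborel \<Otimes>\<^sub>M lborel)"
    by (simp add: lborel_prod)
  have "(\<integral>\<^sup>+y. g y \<partial>weinstein_measure \<alpha>) = (\<integral>\<^sup>+y\<in>half_space. weinstein_density \<alpha> y * g y \<partial>(lborel \<Otimes>\<^sub>M lborel))"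
    by (simp add: nn_integral_weinstein lborel_prod)
  also have "\<dots> = (\<integral>\<^sup>+s. (\<integral>\<^sup>+y'. weinstein_density \<alpha> (y', s) * g (y', s) * indicator half_space (y', s) \<partial>lborel) \<partial>lborel)"
    by (rule lborel_pair.nn_integral_snd[symmetric]) (simp add: lborel_prod)
  also have "\<dots> = (\<integral>\<^sup>+s. ennreal ?k * ((\<integral>\<^sup>+y'. g (y', s) \<partial>lborel) * ennreal (s powr (2 * \<alpha> + 1)) * indicator {0<..} s) \<partial>lborel)"
  proof (rule nn_integral_cong)
    fix s :: real
    have g: "(\<lambda>y'. g (y', s)) \<in> borel_measurable lborel" by simp
    have *: "weinstein_density \<alpha> (y', s) * g (y', s) * indicator half_space (y', s) =
       (ennreal ?k * ennreal (s powr (2 * \<alpha> + 1)) * indicator {0<..} s) * g (y', s)" for y' :: "real ^ 'd"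
      by (auto simp: weinstein_density_def half_space_def ennreal_mult'[symmetric] mult_ac split: split_indicator)
    show "(\<integral>\<^sup>+y'. weinstein_density \<alpha> (y', s) * g (y', s) * indicator half_space (y', s) \<partial>lborel) =
      ennreal ?k * ((\<integral>\<^sup>+y'. g (y', s) \<partial>lborel) * ennreal (s powr (2 * \<alpha> + 1)) * indicator {0<..} s)"
      unfolding * nn_integral_cmult[OF g] by (simp add: mult_ac)
  qed
  also have "\<dots> = ennreal ?k * (\<integral>\<^sup>+s\<in>{0<..}. (\<integral>\<^sup>+y'. g (y', s) \<partial>lborel) * ennreal (s powr (2 * \<alpha> + 1)) \<partial>lborel)"
    by (rule nn_integral_cmult) measurable
  finally show ?thesis .
qed

lemma sigma_finite_weinstein_measure: "sigma_finite_measure (weinstein_measure \<alpha>)"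
  unfolding weinstein_measure_def
  by (subst sigma_finite_measure.sigma_finite_iff_density_finite)
     (auto intro!: sigma_finite_measure_restrict_space lborel.sigma_finite_measure_axioms
        measurable_restrict_space1)

text \<open>
  With \<open>(u,v) = (s cos \<theta>, s sin \<theta>)\<close> one has \<open>r\<^sup>2 + s\<^sup>2 + 2 r s cos \<theta> = (u + r)\<^sup>2 + v\<^sup>2\<close>. Hence the left
  side is the integral of \<open>G (sqrt ((u + r)\<^sup>2 + v\<^sup>2)) v\<^sup>2\<^sup>\<alpha>\<close> over the upper half plane. It does not
  depend on \<open>r\<close>, and at \<open>r = 0\<close> the radial and the angular integral separate.
\<close>

lemma nn_integral_law_of_cosines:
  fixes G :: "real \<Rightarrow> ennreal"
  assumes [measurable]: "G \<in> borel_measurable borel"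
  shows "(\<integral>\<^sup>+s\<in>{0<..}. (\<integral>\<^sup>+\<theta>\<in>{0<..<pi}. G (sqrt (r\<^sup>2 + s\<^sup>2 + 2 * r * s * cos \<theta>)) *
             ennreal (sin \<theta> powr (2 * \<alpha>)) \<partial>lborel) * ennreal (s powr (2 * \<alpha> + 1)) \<partial>lborel) =
         (\<integral>\<^sup>+\<theta>\<in>{0<..<pi}. ennreal (sin \<theta> powr (2 * \<alpha>)) \<partial>lborel) *
         (\<integral>\<^sup>+s\<in>{0<..}. G s * ennreal (s powr (2 * \<alpha> + 1)) \<partial>lborel)"
proof -
  define H where "H r u v = G (sqrt ((u + r)\<^sup>2 + v\<^sup>2)) * ennreal (v powr (2 * \<alpha>))" for r u v :: real
  have H_meas: "(\<lambda>(u, v). H r u v) \<in> borel_measurable (borel \<Otimes>\<^sub>M borel)" for r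
    unfolding H_def by measurable
  have polar: "(\<integral>\<^sup>+v\<in>{0<..}. (\<integral>\<^sup>+u. H r u v \<partial>lborel) \<partial>lborel) =
      (\<integral>\<^sup>+s\<in>{0<..}. (\<integral>\<^sup>+\<theta>\<in>{0<..<pi}. G (sqrt (r\<^sup>2 + s\<^sup>2 + 2 * r * s * cos \<theta>)) *
             ennreal (sin \<theta> powr (2 * \<alpha>)) \<partial>lborel) * ennreal (s powr (2 * \<alpha> + 1)) \<partial>lborel)" for r
    unfolding nn_integral_polar_half_plane[OF H_meas]
  proof (intro nn_integral_cong)
    fix s :: real
    show "(\<integral>\<^sup>+\<theta>\<in>{0<..<pi}. H r (s * cos \<theta>) (s * sin \<theta>) \<partial>lborel) * ennreal s * indicator {0<..} s =
      (\<integral>\<^sup>+\<theta>\<in>{0<..<pi}. G (sqrt (r\<^sup>2 + s\<^sup>2 + 2 * r * s * cos \<theta>)) *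
             ennreal (sin \<theta> powr (2 * \<alpha>)) \<partial>lborel) * ennreal (s powr (2 * \<alpha> + 1)) * indicator {0<..} s"
    proof (cases "s > 0")
      case True
      have "H r (s * cos \<theta>) (s * sin \<theta>) * indicator {0<..<pi} \<theta> =
          G (sqrt (r\<^sup>2 + s\<^sup>2 + 2 * r * s * cos \<theta>)) * ennreal (sin \<theta> powr (2 * \<alpha>)) * indicator {0<..<pi} \<theta> *
          ennreal (s powr (2 * \<alpha>))" for \<theta>
      proof (cases "0 < \<theta> \<and> \<theta> < pi")
        case True
        have "(s * cos \<theta> + r)\<^sup>2 + (s * sin \<theta>)\<^sup>2 = r\<^sup>2 + s\<^sup>2 * ((cos \<theta>)\<^sup>2 + (sin \<theta>)\<^sup>2) + 2 * r * s * cos \<theta>"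
          by (simp only: power2_eq_square) algebra
        then have "(s * cos \<theta> + r)\<^sup>2 + (s * sin \<theta>)\<^sup>2 = r\<^sup>2 + s\<^sup>2 + 2 * r * s * cos \<theta>"
          by simp
        moreover have "sin \<theta> > 0" using True by (simp add: sin_gt_zero)
        ultimately show ?thesis
          using \<open>s > 0\<close> by (simp add: H_def powr_mult ennreal_mult mult_ac)
      qed auto
      then have "(\<integral>\<^sup>+\<theta>\<in>{0<..<pi}. H r (s * cos \<theta>) (s * sin \<theta>) \<partial>lborel) =
        (\<integral>\<^sup>+\<theta>\<in>{0<..<pi}. G (sqrt (r\<^sup>2 + s\<^sup>2 + 2 * r * s * cos \<theta>)) *
             ennreal (sin \<theta> powr (2 * \<alpha>)) \<partial>lborel) * ennreal (s powr (2 * \<alpha>))"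
        by (simp add: nn_integral_multc)
      moreover have "s powr (2 * \<alpha> + 1) = s powr (2 * \<alpha>) * s"
        using True by (simp add: powr_add)
      ultimately show ?thesis
        using True by (simp add: ennreal_mult mult_ac)
    qed simp
  qed
  have "(\<integral>\<^sup>+v\<in>{0<..}. (\<integral>\<^sup>+u. H r u v \<partial>lborel) \<partial>lborel) = (\<integral>\<^sup>+v\<in>{0<..}. (\<integral>\<^sup>+u. H 0 u v \<partial>lborel) \<partial>lborel)"
  proof -
    have "(\<integral>\<^sup>+u. H r u v \<partial>lborel) = (\<integral>\<^sup>+u. H 0 u v \<partial>lborel)" for v
      by (subst (2) nn_integral_real_affine[where c = 1 and t = r])
         (auto simp: H_def add.commute)
    then show ?thesis by simp
  qed
  also have "\<dots> = (\<integral>\<^sup>+s\<in>{0<..}. (\<integral>\<^sup>+\<theta>\<in>{0<..<pi}. ennreal (sin \<theta> powr (2 * \<alpha>)) \<partial>lborel) *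
        (G s * ennreal (s powr (2 * \<alpha> + 1))) \<partial>lborel)"
    unfolding polar
  proof (intro nn_integral_cong)
    fix s :: real
    have "(\<integral>\<^sup>+\<theta>. G (sqrt (0\<^sup>2 + s\<^sup>2 + 2 * 0 * s * cos \<theta>)) * ennreal (sin \<theta> powr (2 * \<alpha>)) * indicator {0<..<pi} \<theta> \<partial>lborel) =
        G s * (\<integral>\<^sup>+\<theta>\<in>{0<..<pi}. ennreal (sin \<theta> powr (2 * \<alpha>)) \<partial>lborel)" if "s > 0"
      using that by (simp add: nn_integral_cmult mult.assoc)
    then show "(\<integral>\<^sup>+\<theta>. G (sqrt (0\<^sup>2 + s\<^sup>2 + 2 * 0 * s * cos \<theta>)) * ennreal (sin \<theta> powr (2 * \<alpha>)) * indicator {0<..<pi} \<theta> \<partial>lborel)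
          * ennreal (s powr (2 * \<alpha> + 1)) * indicator {0<..} s =
        (\<integral>\<^sup>+\<theta>\<in>{0<..<pi}. ennreal (sin \<theta> powr (2 * \<alpha>)) \<partial>lborel) *
        (G s * ennreal (s powr (2 * \<alpha> + 1))) * indicator {0<..} s"
      by (cases "s > 0") (simp_all add: mult_ac)
  qed
  also have "\<dots> = (\<integral>\<^sup>+\<theta>\<in>{0<..<pi}. ennreal (sin \<theta> powr (2 * \<alpha>)) \<partial>lborel) *
         (\<integral>\<^sup>+s\<in>{0<..}. G s * ennreal (s powr (2 * \<alpha> + 1)) \<partial>lborel)"
    by (simp add: nn_integral_cmult mult.assoc)
  finally show ?thesis unfolding polar .
qed

text \<open>
  The translation of nonnegative extended functions: it dominates the translation of complex
  functions and makes sense without any integrability.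
\<close>

definition nn_translation ::
    "real \<Rightarrow> ((real ^ 'd) \<times> real) \<Rightarrow> (((real ^ 'd) \<times> real) \<Rightarrow> ennreal) \<Rightarrow> ((real ^ 'd) \<times> real) \<Rightarrow> ennreal" where
  "nn_translation \<alpha> x g y = ennreal (Gamma (\<alpha> + 1) / (sqrt pi * Gamma (\<alpha> + 1 / 2))) *
     (\<integral>\<^sup>+\<theta>\<in>{0<..<pi}. g (fst x + fst y, sqrt ((snd x)\<^sup>2 + (snd y)\<^sup>2 + 2 * snd x * snd y * cos \<theta>)) *
        ennreal (sin \<theta> powr (2 * \<alpha>)) \<partial>lborel)"

lemma borel_measurable_nn_translation [measurable]:
  assumes [measurable]: "g \<in> borel_measurable borel"
  shows "nn_translation \<alpha> x g \<in> borel_measurable borel"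
  unfolding nn_translation_def[abs_def] by measurable

lemma translation_constant:
  assumes "\<alpha> > - 1 / 2"
  shows "ennreal (Gamma (\<alpha> + 1) / (sqrt pi * Gamma (\<alpha> + 1 / 2))) *
     (\<integral>\<^sup>+\<theta>\<in>{0<..<pi}. ennreal (sin \<theta> powr (2 * \<alpha>)) \<partial>lborel) = 1"
proof -
  have "Gamma (\<alpha> + 1) > 0" "Gamma (\<alpha> + 1 / 2) > 0"
    using assms by (auto intro!: Gamma_real_pos)
  then show ?thesis
    by (simp add: nn_integral_sin_powr[OF assms] ennreal_mult'[symmetric])
qed

lemma nn_integral_nn_translation:
  fixes g :: "((real ^ 'd) \<times> real) \<Rightarrow> ennreal"
  assumes \<alpha>: "\<alpha> > - 1 / 2" and [measurable]: "g \<in> borel_measurable borel"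
  shows "(\<integral>\<^sup>+y. nn_translation \<alpha> x g y \<partial>weinstein_measure \<alpha>) = (\<integral>\<^sup>+y. g y \<partial>weinstein_measure \<alpha>)"
proof -
  define G where "G t = (\<integral>\<^sup>+y'. g (y', t) \<partial>lborel)" for t
  define c where "c = ennreal (Gamma (\<alpha> + 1) / (sqrt pi * Gamma (\<alpha> + 1 / 2)))"
  define k where "k = ennreal (1 / ((2 * pi) ^ CARD('d) * 2 powr (2 * \<alpha>) * (Gamma (\<alpha> + 1))\<^sup>2))"
  have [measurable]: "G \<in> borel_measurable borel" unfolding G_def by measurable
  obtain x' r where x: "x = (x', r)" by (cases x)
  have shift: "(\<integral>\<^sup>+y'. g (x' + y', t) \<partial>lborel) = G t" for t
  proof -
    have "distr lborel borel ((+) x') = lborel" by (rule lborel_distr_plus)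
    then have "G t = (\<integral>\<^sup>+y'. g (y', t) \<partial>distr lborel borel ((+) x'))" by (simp add: G_def)
    then show ?thesis by (simp add: nn_integral_distr)
  qed
  have inner: "(\<integral>\<^sup>+y'. nn_translation \<alpha> x g (y', s) \<partial>lborel) =
      c * (\<integral>\<^sup>+\<theta>\<in>{0<..<pi}. G (sqrt (r\<^sup>2 + s\<^sup>2 + 2 * r * s * cos \<theta>)) * ennreal (sin \<theta> powr (2 * \<alpha>)) \<partial>lborel)" for s
  proof -
    have "(\<integral>\<^sup>+y'. nn_translation \<alpha> x g (y', s) \<partial>lborel) =
        c * (\<integral>\<^sup>+y'. (\<integral>\<^sup>+\<theta>. g (x' + y', sqrt (r\<^sup>2 + s\<^sup>2 + 2 * r * s * cos \<theta>)) *
        ennreal (sin \<theta> powr (2 * \<alpha>)) * indicator {0<..<pi} \<theta> \<partial>lborel) \<partial>lborel)"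
      by (simp add: nn_translation_def x c_def nn_integral_cmult)
    also have "(\<integral>\<^sup>+y'. (\<integral>\<^sup>+\<theta>. g (x' + y', sqrt (r\<^sup>2 + s\<^sup>2 + 2 * r * s * cos \<theta>)) *
        ennreal (sin \<theta> powr (2 * \<alpha>)) * indicator {0<..<pi} \<theta> \<partial>lborel) \<partial>lborel) =
      (\<integral>\<^sup>+\<theta>. (\<integral>\<^sup>+y'. g (x' + y', sqrt (r\<^sup>2 + s\<^sup>2 + 2 * r * s * cos \<theta>)) *
        ennreal (sin \<theta> powr (2 * \<alpha>)) * indicator {0<..<pi} \<theta> \<partial>lborel) \<partial>lborel)"
      by (rule lborel_pair.Fubini') measurable
    also have "\<dots> = (\<integral>\<^sup>+\<theta>\<in>{0<..<pi}. G (sqrt (r\<^sup>2 + s\<^sup>2 + 2 * r * s * cos \<theta>)) * ennreal (sin \<theta> powr (2 * \<alpha>)) \<partial>lborel)"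
      by (simp add: nn_integral_multc shift mult.assoc)
    finally show ?thesis .
  qed
  define X where "X s = (\<integral>\<^sup>+\<theta>\<in>{0<..<pi}. G (sqrt (r\<^sup>2 + s\<^sup>2 + 2 * r * s * cos \<theta>)) *
        ennreal (sin \<theta> powr (2 * \<alpha>)) \<partial>lborel)" for s
  have [measurable]: "X \<in> borel_measurable borel" unfolding X_def by measurable
  have "(\<integral>\<^sup>+y. nn_translation \<alpha> x g y \<partial>weinstein_measure \<alpha>) =
      k * (\<integral>\<^sup>+s. c * (X s * ennreal (s powr (2 * \<alpha> + 1)) * indicator {0<..} s) \<partial>lborel)"
    by (simp add: nn_integral_weinstein_iterated inner k_def X_def mult.assoc)
  also have "\<dots> = k * (c * (\<integral>\<^sup>+s\<in>{0<..}. X s * ennreal (s powr (2 * \<alpha> + 1)) \<partial>lborel))"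
    by (subst nn_integral_cmult) auto
  also have "\<dots> = k * (c * (\<integral>\<^sup>+\<theta>\<in>{0<..<pi}. ennreal (sin \<theta> powr (2 * \<alpha>)) \<partial>lborel) *
      (\<integral>\<^sup>+s\<in>{0<..}. G s * ennreal (s powr (2 * \<alpha> + 1)) \<partial>lborel))"
    unfolding X_def by (subst nn_integral_law_of_cosines) (simp_all add: mult.assoc)
  also have "\<dots> = (\<integral>\<^sup>+y. g y \<partial>weinstein_measure \<alpha>)"
    unfolding c_def translation_constant[OF \<alpha>] by (simp add: nn_integral_weinstein_iterated k_def G_def)
  finally show ?thesis .
qed

text \<open>
  The measure is homogeneous of degree \<open>2 \<alpha> + d + 2\<close>: the density contributes \<open>2 \<alpha> + 1\<close> and
  Lebesgue measure \<open>d + 1\<close>.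
\<close>

lemma nn_integral_weinstein_scale:
  fixes g :: "((real ^ 'd) \<times> real) \<Rightarrow> ennreal"
  assumes "a > 0" and [measurable]: "g \<in> borel_measurable borel"
  shows "(\<integral>\<^sup>+y. g (y /\<^sub>R a) \<partial>weinstein_measure \<alpha>) =
         ennreal (a powr (2 * \<alpha> + real CARD('d) + 2)) * (\<integral>\<^sup>+y. g y \<partial>weinstein_measure \<alpha>)"
proof -
  let ?D = "weinstein_density \<alpha> :: ((real ^ 'd) \<times> real) \<Rightarrow> ennreal"
  have pos: "ennreal (a powr (2 * \<alpha> + 1)) * ennreal (a ^ (CARD('d) + 1)) =
      ennreal (a powr (2 * \<alpha> + real CARD('d) + 2))"
  proof -
    have "a ^ (CARD('d) + 1) = a powr (real CARD('d) + 1)"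
      using powr_realpow[OF \<open>a > 0\<close>, of "CARD('d) + 1"] by (simp add: add.commute)
    then have "a powr (2 * \<alpha> + 1) * a ^ (CARD('d) + 1) = a powr (2 * \<alpha> + real CARD('d) + 2)"
      by (simp add: powr_add[symmetric] add_ac del: power_Suc)
    then show ?thesis by (simp only: ennreal_mult'[OF powr_ge_zero, symmetric])
  qed
  have dens: "?D (a *\<^sub>R y) * indicator half_space (a *\<^sub>R y) =
      ennreal (a powr (2 * \<alpha> + 1)) * (?D y * indicator half_space y)" for y
    using \<open>a > 0\<close>
    by (auto simp: weinstein_density_def half_space_def zero_less_mult_iff powr_mult
          ennreal_mult'[symmetric] split: split_indicator)
  have "(\<integral>\<^sup>+y. g (y /\<^sub>R a) \<partial>weinstein_measure \<alpha>) = (\<integral>\<^sup>+y. ?D y * g (y /\<^sub>R a) * indicator half_space y \<partial>lborel)"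
    by (simp add: nn_integral_weinstein)
  also have "\<dots> = (\<integral>\<^sup>+y. ?D y * g (y /\<^sub>R a) * indicator half_space y
      \<partial>density (distr lborel borel (\<lambda>x. 0 + a *\<^sub>R x)) (\<lambda>_. \<bar>a\<bar> ^ DIM((real ^ 'd) \<times> real)))"
    using \<open>a > 0\<close> by (subst lborel_affine[of a 0]) simp_all
  also have "\<dots> = (\<integral>\<^sup>+y. ennreal (a ^ (CARD('d) + 1)) * (?D (a *\<^sub>R y) * g y * indicator half_space (a *\<^sub>R y)) \<partial>lborel)"
    using \<open>a > 0\<close> by (simp add: nn_integral_density nn_integral_distr DIM_prod)
  also have "\<dots> = (\<integral>\<^sup>+y. ennreal (a powr (2 * \<alpha> + real CARD('d) + 2)) * (?D y * g y * indicator half_space y) \<partial>lborel)"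
  proof (rule nn_integral_cong)
    fix y
    have "ennreal (a ^ (CARD('d) + 1)) * (?D (a *\<^sub>R y) * g y * indicator half_space (a *\<^sub>R y)) =
       ennreal (a ^ (CARD('d) + 1)) * ((?D (a *\<^sub>R y) * indicator half_space (a *\<^sub>R y)) * g y)"
      by (simp only: mult_ac)
    then show "ennreal (a ^ (CARD('d) + 1)) * (?D (a *\<^sub>R y) * g y * indicator half_space (a *\<^sub>R y)) =
      ennreal (a powr (2 * \<alpha> + real CARD('d) + 2)) * (?D y * g y * indicator half_space y)"
      unfolding dens pos[symmetric] by (simp only: mult_ac)
  qed
  also have "\<dots> = ennreal (a powr (2 * \<alpha> + real CARD('d) + 2)) * (\<integral>\<^sup>+y. g y \<partial>weinstein_measure \<alpha>)"
    by (simp add: nn_integral_cmult nn_integral_weinstein)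
  finally show ?thesis .
qed


section \<open>Bounds for translates and wavelets\<close>

lemma nn_translation_add:
  assumes [measurable]: "g \<in> borel_measurable borel" "h \<in> borel_measurable borel"
  shows "nn_translation \<alpha> x (\<lambda>z. g z + h z) y = nn_translation \<alpha> x g y + nn_translation \<alpha> x h y"
  unfolding nn_translation_def
  by (simp add: distrib_left[symmetric] nn_integral_add[symmetric] distrib_right)

lemma nn_translation_cmult:
  assumes [measurable]: "g \<in> borel_measurable borel"
  shows "nn_translation \<alpha> x (\<lambda>z. c * g z) y = c * nn_translation \<alpha> x g y"
  unfolding nn_translation_def
  by (simp add: mult.left_commute[of c] nn_integral_cmult[symmetric] mult.assoc)

lemma nn_translation_mono:
  assumes "\<And>z. g z \<le> h z"
  shows "nn_translation \<alpha> x g y \<le> nn_translation \<alpha> x h y"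
  unfolding nn_translation_def
  by (intro mult_left_mono nn_integral_mono mult_right_mono assms) auto

lemma nn_translation_const:
  assumes "\<alpha> > - 1 / 2"
  shows "nn_translation \<alpha> x (\<lambda>z. c) y = c"
proof -
  have "nn_translation \<alpha> x (\<lambda>z. c * 1) y = c * nn_translation \<alpha> x (\<lambda>z. 1) y"
    by (rule nn_translation_cmult) simp
  also have "nn_translation \<alpha> x (\<lambda>z. 1) y = 1"
    using translation_constant[OF assms] by (simp add: nn_translation_def)
  finally show ?thesis by simp
qed

text \<open>
  For a fixed \<open>y\<close> the translation only uses the values of \<open>g\<close> on an arc, which is a null set, so
  an a.e. bound on \<open>g\<close> says nothing at a single \<open>y\<close>. But the translate of the indicator of the
  exceptional set \<open>N\<close> has integral \<open>0\<close>, hence vanishes at almost every \<open>y\<close>, and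
  \<open>g \<le> C + \<infinity> 1\<^sub>N\<close>.
\<close>

lemma AE_nn_translation_le:
  fixes g :: "((real ^ 'd) \<times> real) \<Rightarrow> ennreal"
  assumes \<alpha>: "\<alpha> > - 1 / 2" and [measurable]: "g \<in> borel_measurable borel"
    and bound: "AE y in weinstein_measure \<alpha>. g y \<le> C"
  shows "AE y in weinstein_measure \<alpha>. nn_translation \<alpha> x g y \<le> C"
proof -
  define N where "N = {y. C < g y}"
  have [measurable]: "N \<in> sets borel" unfolding N_def by measurable
  have "AE y in weinstein_measure \<alpha>. indicator N y = (0::ennreal)"
    using bound by eventually_elim (auto simp: N_def)
  then have "(\<integral>\<^sup>+y. indicator N y \<partial>weinstein_measure \<alpha>) = 0"
    by (subst nn_integral_0_iff_AE) (auto intro: borel_measurable_weinsteinI)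
  then have "(\<integral>\<^sup>+y. nn_translation \<alpha> x (indicator N) y \<partial>weinstein_measure \<alpha>) = 0"
    by (simp add: nn_integral_nn_translation[OF \<alpha>])
  then have "AE y in weinstein_measure \<alpha>. nn_translation \<alpha> x (indicator N) y = 0"
    by (subst (asm) nn_integral_0_iff_AE) (auto intro!: borel_measurable_weinsteinI)
  then show ?thesis
  proof eventually_elim
    case (elim y)
    have "nn_translation \<alpha> x g y \<le> nn_translation \<alpha> x (\<lambda>z. C + \<infinity> * indicator N z) y"
      by (rule nn_translation_mono) (auto simp: N_def not_less split: split_indicator)
    also have "\<dots> = nn_translation \<alpha> x (\<lambda>z. C) y + nn_translation \<alpha> x (\<lambda>z. \<infinity> * indicator N z) y"
      by (rule nn_translation_add) auto
    also have "\<dots> = C"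
      using elim by (simp add: nn_translation_cmult nn_translation_const[OF \<alpha>])
    finally show ?case .
  qed
qed

lemma AE_weinstein_scale_le:
  fixes g :: "((real ^ 'd) \<times> real) \<Rightarrow> ennreal"
  assumes "a > 0" and [measurable]: "g \<in> borel_measurable borel"
    and bound: "AE y in weinstein_measure \<alpha>. g y \<le> C"
  shows "AE y in weinstein_measure \<alpha>. g (y /\<^sub>R a) \<le> C"
proof -
  define N where "N = {y. C < g y}"
  have [measurable]: "N \<in> sets borel" unfolding N_def by measurable
  have "AE y in weinstein_measure \<alpha>. indicator N y = (0::ennreal)"
    using bound by eventually_elim (auto simp: N_def)
  then have "(\<integral>\<^sup>+y. indicator N y \<partial>weinstein_measure \<alpha>) = 0"
    by (subst nn_integral_0_iff_AE) (auto intro: borel_measurable_weinsteinI)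
  then have "(\<integral>\<^sup>+y. indicator N (y /\<^sub>R a) \<partial>weinstein_measure \<alpha>) = 0"
    using \<open>a > 0\<close> by (subst nn_integral_weinstein_scale) auto
  then have "AE y in weinstein_measure \<alpha>. indicator N (y /\<^sub>R a) = (0::ennreal)"
    by (subst (asm) nn_integral_0_iff_AE) (auto intro!: borel_measurable_weinsteinI)
  then show ?thesis
    by eventually_elim (auto simp: N_def not_less indicator_eq_0_iff)
qed

lemma translation_conv_lborel:
  "translation \<alpha> x \<phi> y =
     complex_of_real (Gamma (\<alpha> + 1) / (sqrt pi * Gamma (\<alpha> + 1 / 2))) *
     (\<integral>\<theta>. indicator {0<..<pi} \<theta> *\<^sub>R
        (\<phi> (fst x + fst y, sqrt ((snd x)\<^sup>2 + (snd y)\<^sup>2 + 2 * snd x * snd y * cos \<theta>)) *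
        complex_of_real (sin \<theta> powr (2 * \<alpha>))) \<partial>lborel)"
  by (simp add: translation_def interval_lebesgue_integral_def set_lebesgue_integral_def zero_ereal_def)

text \<open>
  For \<open>0 < \<theta> < \<pi>\<close> the law of cosines gives a positive number,
  \<open>(r - s)\<^sup>2 + 2 r s (1 + cos \<theta>)\<close>, so the values outside the half-space do not enter.
\<close>

lemma translation_cong:
  assumes "x \<in> half_space" "y \<in> half_space" and eq: "\<And>z. z \<in> half_space \<Longrightarrow> \<phi> z = \<psi> z"
  shows "translation \<alpha> x \<phi> y = translation \<alpha> x \<psi> y"
proof -
  have "(fst x + fst y, sqrt ((snd x)\<^sup>2 + (snd y)\<^sup>2 + 2 * snd x * snd y * cos \<theta>)) \<in> half_space"
    if "\<theta> \<in> {0<..<pi}" for \<theta>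
  proof -
    have "cos pi < cos \<theta>"
      using that by (intro cos_monotone_0_pi) auto
    then have "0 < 2 * (snd x * snd y * (1 + cos \<theta>))"
      using assms by (auto simp: half_space_def)
    moreover have "(snd x)\<^sup>2 + (snd y)\<^sup>2 + 2 * snd x * snd y * cos \<theta> =
        (snd x - snd y)\<^sup>2 + 2 * (snd x * snd y * (1 + cos \<theta>))"
      by (simp add: power2_eq_square algebra_simps)
    ultimately have "0 < (snd x)\<^sup>2 + (snd y)\<^sup>2 + 2 * snd x * snd y * cos \<theta>"
      by (simp add: add_nonneg_pos)
    then show ?thesis by (simp add: half_space_def)
  qed
  then show ?thesis
    unfolding translation_conv_lborel
    by (intro arg_cong2[where f = "(*)"] refl Bochner_Integration.integral_cong)
       (auto simp: eq split: split_indicator)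
qed

lemma norm_translation_le:
  assumes "\<alpha> > - 1 / 2"
  shows "ennreal (cmod (translation \<alpha> x \<phi> y)) \<le> nn_translation \<alpha> x (\<lambda>z. ennreal (cmod (\<phi> z))) y"
proof -
  define F where "F \<theta> = indicator {0<..<pi} \<theta> *\<^sub>R
        (\<phi> (fst x + fst y, sqrt ((snd x)\<^sup>2 + (snd y)\<^sup>2 + 2 * snd x * snd y * cos \<theta>)) *
        complex_of_real (sin \<theta> powr (2 * \<alpha>)))" for \<theta>
  define c where "c = Gamma (\<alpha> + 1) / (sqrt pi * Gamma (\<alpha> + 1 / 2))"
  have "Gamma (\<alpha> + 1) > 0" "Gamma (\<alpha> + 1 / 2) > 0"
    using assms by (auto intro!: Gamma_real_pos)
  then have "c \<ge> 0" by (simp add: c_def)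
  \<comment> \<open>If \<open>F\<close> is not integrable, its integral is \<open>0\<close> by convention.\<close>
  have "ennreal (cmod (integral\<^sup>L lborel F)) \<le> (\<integral>\<^sup>+\<theta>. ennreal (cmod (F \<theta>)) \<partial>lborel)"
    by (cases "integrable lborel F") (auto simp: not_integrable_integral_eq intro: integral_norm_bound_ennreal)
  moreover have "ennreal (cmod (translation \<alpha> x \<phi> y)) = ennreal c * ennreal (cmod (integral\<^sup>L lborel F))"
    using \<open>c \<ge> 0\<close>
    by (simp add: translation_conv_lborel F_def[symmetric] c_def[symmetric] norm_mult ennreal_mult)
  moreover have "nn_translation \<alpha> x (\<lambda>z. ennreal (cmod (\<phi> z))) y = ennreal c * (\<integral>\<^sup>+\<theta>. ennreal (cmod (F \<theta>)) \<partial>lborel)"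
    unfolding nn_translation_def c_def[symmetric] F_def
    by (intro arg_cong2[where f = "(*)"] refl nn_integral_cong)
       (auto simp: norm_mult ennreal_mult split: split_indicator)
  ultimately show ?thesis by (simp add: mult_left_mono)
qed

text \<open>
  A window is measurable on the half-space only. Extending it by zero gives a Borel function on
  the whole space with the same wavelets, for which measurability and the bounds above apply.
\<close>

definition zero_extension :: "(((real ^ 'd) \<times> real) \<Rightarrow> complex) \<Rightarrow> ((real ^ 'd) \<times> real) \<Rightarrow> complex" where
  "zero_extension \<phi> = (\<lambda>x. indicator half_space x *\<^sub>R \<phi> x)"

lemma borel_measurable_zero_extension [measurable]:
  "\<phi> \<in> borel_measurable (weinstein_measure \<alpha>) \<Longrightarrow> zero_extension \<phi> \<in> borel_measurable borel"
  by (simp add: zero_extension_def measurable_cong_sets[OF sets_weinstein_measure refl]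
        borel_measurable_restrict_space_iff)

lemma wavelet_zero_extension:
  assumes "a > 0" "x \<in> half_space" "y \<in> half_space"
  shows "wavelet \<alpha> \<phi> a x y = wavelet \<alpha> (zero_extension \<phi>) a x y"
  unfolding wavelet_def
  by (intro arg_cong2[where f = "(*)"] refl translation_cong assms)
     (use assms in \<open>auto simp: dilation_def zero_extension_def half_space_def indicator_def\<close>)

text \<open>
  The exponent is \<open>\<kappa> - 2 \<kappa> = - \<kappa>\<close>, where \<open>\<kappa> = \<alpha> + 1 + d/2\<close>: the normalisation contributes
  \<open>\<kappa>\<close> and the dilation \<open>- (2 \<alpha> + d + 2)\<close>.
\<close>

lemma norm_wavelet_le:
  fixes \<phi> :: "((real ^ 'd) \<times> real) \<Rightarrow> complex"
  assumes "\<alpha> > - 1 / 2" "a > 0" and [measurable]: "\<phi> \<in> borel_measurable borel"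
  shows "ennreal (cmod (wavelet \<alpha> \<phi> a x y)) \<le>
    ennreal (a powr (- (\<alpha> + 1 + real CARD('d) / 2))) * nn_translation \<alpha> x (\<lambda>z. ennreal (cmod (\<phi> (z /\<^sub>R a)))) y"
proof -
  let ?k = "\<alpha> + 1 + real CARD('d) / 2"
  have "ennreal (cmod (wavelet \<alpha> \<phi> a x y)) = ennreal (a powr ?k) * ennreal (cmod (translation \<alpha> x (dilation \<alpha> a \<phi>) y))"
    by (simp add: wavelet_def norm_mult ennreal_mult)
  also have "\<dots> \<le> ennreal (a powr ?k) * nn_translation \<alpha> x (\<lambda>z. ennreal (cmod (dilation \<alpha> a \<phi> z))) y"
    by (intro mult_left_mono norm_translation_le assms) auto
  also have "nn_translation \<alpha> x (\<lambda>z. ennreal (cmod (dilation \<alpha> a \<phi> z))) y =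
      ennreal (a powr (- (2 * ?k))) * nn_translation \<alpha> x (\<lambda>z. ennreal (cmod (\<phi> (z /\<^sub>R a)))) y"
    by (subst nn_translation_cmult[symmetric])
       (auto simp: dilation_def norm_mult ennreal_mult algebra_simps)
  also have "ennreal (a powr ?k) * (ennreal (a powr (- (2 * ?k))) * nn_translation \<alpha> x (\<lambda>z. ennreal (cmod (\<phi> (z /\<^sub>R a)))) y) =
      ennreal (a powr (- ?k)) * nn_translation \<alpha> x (\<lambda>z. ennreal (cmod (\<phi> (z /\<^sub>R a)))) y"
  proof -
    have "?k + - (2 * ?k) = - ?k" by simp
    then show ?thesis
      unfolding mult.assoc[symmetric] ennreal_mult'[OF powr_ge_zero, symmetric] powr_add[symmetric]
      by (simp only:)
  qed
  finally show ?thesis .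
qed

lemma nn_integral_wavelet_le:
  fixes \<phi> :: "((real ^ 'd) \<times> real) \<Rightarrow> complex"
  assumes \<alpha>: "\<alpha> > - 1 / 2" and "a > 0" "x \<in> half_space"
    and \<phi>: "\<phi> \<in> borel_measurable (weinstein_measure \<alpha>)"
  shows "(\<integral>\<^sup>+y. ennreal (cmod (wavelet \<alpha> \<phi> a x y)) \<partial>weinstein_measure \<alpha>) \<le>
    ennreal (a powr (\<alpha> + 1 + real CARD('d) / 2)) * (\<integral>\<^sup>+y. ennreal (cmod (\<phi> y)) \<partial>weinstein_measure \<alpha>)"
proof -
  let ?k = "\<alpha> + 1 + real CARD('d) / 2" and ?W = "weinstein_measure \<alpha> :: ((real ^ 'd) \<times> real) measure"
  note [measurable] = borel_measurable_zero_extension[OF \<phi>]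
  let ?g = "\<lambda>z. ennreal (cmod (zero_extension \<phi> z))"
  have "(\<integral>\<^sup>+y. ennreal (cmod (wavelet \<alpha> \<phi> a x y)) \<partial>?W) =
      (\<integral>\<^sup>+y. ennreal (cmod (wavelet \<alpha> (zero_extension \<phi>) a x y)) \<partial>?W)"
    by (intro nn_integral_cong) (simp add: wavelet_zero_extension[OF assms(2,3), of _ \<alpha> \<phi>])
  also have "\<dots> \<le> (\<integral>\<^sup>+y. ennreal (a powr (- ?k)) * nn_translation \<alpha> x (\<lambda>z. ?g (z /\<^sub>R a)) y \<partial>?W)"
    by (intro nn_integral_mono norm_wavelet_le assms) auto
  also have "\<dots> = ennreal (a powr (- ?k)) * (ennreal (a powr (2 * \<alpha> + real CARD('d) + 2)) * (\<integral>\<^sup>+y. ?g y \<partial>?W))"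
    using \<open>a > 0\<close>
    by (subst nn_integral_cmult)
       (auto simp: nn_integral_nn_translation[OF \<alpha>] nn_integral_weinstein_scale[where g = ?g] intro!: borel_measurable_weinsteinI)
  also have "\<dots> = ennreal (a powr ?k) * (\<integral>\<^sup>+y. ?g y \<partial>?W)"
    unfolding mult.assoc[symmetric] ennreal_mult'[OF powr_ge_zero, symmetric] powr_add[symmetric]
    by (simp add: algebra_simps)
  also have "(\<integral>\<^sup>+y. ?g y \<partial>?W) = (\<integral>\<^sup>+y. ennreal (cmod (\<phi> y)) \<partial>?W)"
    by (intro nn_integral_cong) (simp add: zero_extension_def)
  finally show ?thesis .
qed

lemma AE_wavelet_le:
  fixes \<phi> :: "((real ^ 'd) \<times> real) \<Rightarrow> complex"
  assumes \<alpha>: "\<alpha> > - 1 / 2" and "a > 0" "x \<in> half_space"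
    and \<phi>: "\<phi> \<in> borel_measurable (weinstein_measure \<alpha>)"
    and bound: "AE y in weinstein_measure \<alpha>. ennreal (cmod (\<phi> y)) \<le> C"
  shows "AE y in weinstein_measure \<alpha>. ennreal (cmod (wavelet \<alpha> \<phi> a x y)) \<le>
           ennreal (a powr (- (\<alpha> + 1 + real CARD('d) / 2))) * C"
proof -
  note [measurable] = borel_measurable_zero_extension[OF \<phi>]
  let ?g = "\<lambda>z. ennreal (cmod (zero_extension \<phi> z))"
  have "AE y in weinstein_measure \<alpha>. ?g y \<le> C"
    using bound AE_space by eventually_elim (simp add: zero_extension_def)
  then have "AE y in weinstein_measure \<alpha>. ?g (y /\<^sub>R a) \<le> C"
    using \<open>a > 0\<close> by (intro AE_weinstein_scale_le) auto
  then have "AE y in weinstein_measure \<alpha>. nn_translation \<alpha> x (\<lambda>z. ?g (z /\<^sub>R a)) y \<le> C"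
    by (intro AE_nn_translation_le \<alpha>) auto
  then show ?thesis
    using AE_space
  proof eventually_elim
    case (elim y)
    have "ennreal (cmod (wavelet \<alpha> \<phi> a x y)) = ennreal (cmod (wavelet \<alpha> (zero_extension \<phi>) a x y))"
      using elim assms by (simp add: wavelet_zero_extension[of a x y \<alpha> \<phi>])
    also have "\<dots> \<le> ennreal (a powr (- (\<alpha> + 1 + real CARD('d) / 2))) * nn_translation \<alpha> x (\<lambda>z. ?g (z /\<^sub>R a)) y"
      by (intro norm_wavelet_le assms) auto
    also have "\<dots> \<le> ennreal (a powr (- (\<alpha> + 1 + real CARD('d) / 2))) * C"
      using elim by (intro mult_left_mono) auto
    finally show ?case .
  qed
qed

lemma space_scale_measure_X: "space (scale_measure_X \<alpha>) = {0<..} \<times> half_space"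
  by (simp add: scale_measure_X_def space_pair_measure space_restrict_space)

lemma measurable_scale_measure_X_borel [measurable]:
  "(\<lambda>z. z) \<in> scale_measure_X \<alpha> \<rightarrow>\<^sub>M borel \<Otimes>\<^sub>M borel"
proof -
  have "(\<lambda>z. z) \<in> restrict_space lborel {0<..} \<Otimes>\<^sub>M weinstein_measure \<alpha> \<rightarrow>\<^sub>M borel \<Otimes>\<^sub>M borel"
    by (intro measurable_pair)
       (auto simp: comp_def intro!: measurable_compose[OF measurable_fst] measurable_compose[OF measurable_snd]
         measurable_restrict_space1 borel_measurable_weinsteinI)
  then show ?thesis by (simp add: scale_measure_X_def)
qed

lemma sigma_finite_scale_measure_X: "sigma_finite_measure (scale_measure_X \<alpha> :: (real \<times> ((real ^ 'd) \<times> real)) measure)"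
proof -
  interpret W: sigma_finite_measure "weinstein_measure \<alpha> :: ((real ^ 'd) \<times> real) measure"
    by (rule sigma_finite_weinstein_measure)
  interpret A: sigma_finite_measure "restrict_space lborel {0<..} :: real measure"
    by (intro sigma_finite_measure_restrict_space lborel.sigma_finite_measure_axioms) simp
  interpret P: pair_sigma_finite "restrict_space lborel {0<..} :: real measure" "weinstein_measure \<alpha> :: ((real ^ 'd) \<times> real) measure" ..
  have [measurable]: "(\<lambda>a. a) \<in> borel_measurable (restrict_space lborel {0::real<..})"
    by (intro measurable_restrict_space1) simp
  show ?thesis
    unfolding scale_measure_X_def
    by (subst P.sigma_finite_iff_density_finite) (measurable, auto)
qed

lemma borel_measurable_wavelet:
  fixes \<phi> :: "((real ^ 'd) \<times> real) \<Rightarrow> complex"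
  assumes \<phi>: "\<phi> \<in> borel_measurable (weinstein_measure \<alpha>)"
  shows "(\<lambda>(z, y). wavelet \<alpha> \<phi> (fst z) (snd z) y) \<in>
      borel_measurable (scale_measure_X \<alpha> \<Otimes>\<^sub>M weinstein_measure \<alpha>)"
proof -
  note [measurable] = borel_measurable_zero_extension[OF \<phi>]
  have *: "(\<lambda>(z, y). wavelet \<alpha> (zero_extension \<phi>) (fst z) (snd z) y) \<in>
      borel_measurable ((borel \<Otimes>\<^sub>M borel) \<Otimes>\<^sub>M borel)"
    unfolding wavelet_def translation_conv_lborel dilation_def by measurable
  have "(\<lambda>p. p) \<in> scale_measure_X \<alpha> \<Otimes>\<^sub>M (weinstein_measure \<alpha> :: ((real ^ 'd) \<times> real) measure) \<rightarrow>\<^sub>M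
      ((borel \<Otimes>\<^sub>M borel) \<Otimes>\<^sub>M borel)"
    by (intro measurable_pair)
       (auto simp: comp_def intro!: measurable_compose[OF measurable_fst] measurable_compose[OF measurable_snd]
          measurable_scale_measure_X_borel borel_measurable_weinsteinI)
  from measurable_compose[OF this *]
  have "(\<lambda>(z, y). wavelet \<alpha> (zero_extension \<phi>) (fst z) (snd z) y) \<in>
      borel_measurable (scale_measure_X \<alpha> \<Otimes>\<^sub>M weinstein_measure \<alpha>)" by simp
  also have "?this \<longleftrightarrow> ?thesis"
    by (intro measurable_cong)
       (auto simp: space_pair_measure space_scale_measure_X wavelet_zero_extension[of _ _ _ \<alpha> \<phi>])
  finally show ?thesis .
qed


section \<open>Lebesgue spaces and Schur's test\<close>

lemma Lp_fun_measurable: "f \<in> Lp_fun M p \<Longrightarrow> f \<in> borel_measurable M"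
  by (simp add: Lp_fun_def)

lemma enn2real_exponent_ge_1:
  assumes "1 \<le> p" "p \<noteq> \<infinity>"
  shows "1 \<le> enn2real p"
  using enn2real_mono[OF assms(1)] assms(2) by (simp add: top.not_eq_extremum)

lemma Lp_fun_finite_iff:
  assumes "p \<noteq> \<infinity>"
  shows "f \<in> Lp_fun M p \<longleftrightarrow> f \<in> borel_measurable M \<and>
           (\<integral>\<^sup>+x. ennreal (cmod (f x) powr enn2real p) \<partial>M) < \<infinity>"
  using assms by (auto simp: Lp_fun_def integrable_iff_bounded)

lemma AE_le_Lp_norm_infinity:
  assumes "f \<in> Lp_fun M \<infinity>"
  shows "AE x in M. cmod (f x) \<le> Lp_norm M \<infinity> f"
proof -
  let ?E = "esssup M (\<lambda>x. ennreal (cmod (f x)))"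
  have "?E < top" using assms by (simp add: Lp_fun_def)
  have "AE x in M. ennreal (cmod (f x)) \<le> ?E" by (rule esssup_AE)
  then show ?thesis
  proof eventually_elim
    case (elim x)
    then show ?case using enn2real_mono[OF elim \<open>?E < top\<close>] by (simp add: Lp_norm_def)
  qed
qed

lemma Lp_fun_infinity_iff:
  assumes "p = \<infinity>"
  shows "f \<in> Lp_fun M p \<longleftrightarrow> f \<in> borel_measurable M \<and> (\<exists>C. AE x in M. cmod (f x) \<le> C)"
proof
  assume "f \<in> Lp_fun M p"
  then show "f \<in> borel_measurable M \<and> (\<exists>C. AE x in M. cmod (f x) \<le> C)"
    using AE_le_Lp_norm_infinity[of f M] assms by (auto simp: Lp_fun_measurable)
next
  assume f: "f \<in> borel_measurable M \<and> (\<exists>C. AE x in M. cmod (f x) \<le> C)"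
  then obtain C where "AE x in M. cmod (f x) \<le> C" by blast
  then have "AE x in M. ennreal (cmod (f x)) \<le> ennreal C"
    by eventually_elim (rule ennreal_leI)
  then have "esssup M (\<lambda>x. ennreal (cmod (f x))) \<le> ennreal C"
    using f by (intro esssup_I) auto
  then show "f \<in> Lp_fun M p"
    using f assms by (auto simp: Lp_fun_def intro: le_less_trans)
qed

lemma Lp_norm_nonneg: "0 \<le> Lp_norm M p f"
  by (simp add: Lp_norm_def)

lemma nn_integral_eq_Lp_norm_1:
  assumes "f \<in> Lp_fun M 1"
  shows "(\<integral>\<^sup>+x. ennreal (cmod (f x)) \<partial>M) = ennreal (Lp_norm M 1 f)"
  using assms by (simp add: Lp_fun_def Lp_norm_def nn_integral_eq_integral)

lemma Lp_fun_zero: "(\<lambda>x. 0) \<in> Lp_fun M p"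
proof (cases "p = \<infinity>")
  case True
  show ?thesis by (auto simp: Lp_fun_infinity_iff[OF True] intro!: exI[of _ 0])
next
  case False
  then show ?thesis by (simp add: Lp_fun_finite_iff)
qed

lemma Lp_fun_scale:
  assumes f: "f \<in> Lp_fun M p"
  shows "(\<lambda>x. c * f x) \<in> Lp_fun M p"
proof (cases "p = \<infinity>")
  case True
  obtain C where "AE x in M. cmod (f x) \<le> C"
    using f by (auto simp: Lp_fun_infinity_iff[OF True])
  then have "AE x in M. cmod (c * f x) \<le> cmod c * C"
    by eventually_elim (simp add: norm_mult mult_left_mono)
  then show ?thesis using Lp_fun_measurable[OF f] by (auto simp: Lp_fun_infinity_iff[OF True])
next
  case False
  then have "integrable M (\<lambda>x. cmod (f x) powr enn2real p)"
    using f by (simp add: Lp_fun_def)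
  then have "integrable M (\<lambda>x. cmod (c * f x) powr enn2real p)"
    by (simp add: norm_mult powr_mult)
  then show ?thesis using Lp_fun_measurable[OF f] False by (simp add: Lp_fun_def)
qed

lemma Lp_fun_add:
  assumes f: "f \<in> Lp_fun M p" and g: "g \<in> Lp_fun M p"
  shows "(\<lambda>x. f x + g x) \<in> Lp_fun M p"
proof (cases "p = \<infinity>")
  case True
  obtain C D where "AE x in M. cmod (f x) \<le> C" "AE x in M. cmod (g x) \<le> D"
    using f g by (auto simp: Lp_fun_infinity_iff[OF True])
  then have "AE x in M. cmod (f x + g x) \<le> C + D"
    by eventually_elim (rule norm_triangle_mono)
  then show ?thesis using Lp_fun_measurable[OF f] Lp_fun_measurable[OF g]
    by (auto simp: Lp_fun_infinity_iff[OF True])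
next
  case False
  let ?q = "enn2real p"
  have [measurable]: "f \<in> borel_measurable M" "g \<in> borel_measurable M"
    using f g by (auto intro: Lp_fun_measurable)
  have int: "integrable M (\<lambda>x. cmod (2 * f x) powr ?q + cmod (2 * g x) powr ?q)"
    using Lp_fun_scale[OF f, of 2] Lp_fun_scale[OF g, of 2] False by (simp add: Lp_fun_def)
  have bound: "cmod (f x + g x) powr ?q \<le> cmod (2 * f x) powr ?q + cmod (2 * g x) powr ?q" for x
  proof -
    \<comment> \<open>\<open>|f + g| \<le> 2 max |f| |g|\<close>, and the power of a maximum is at most the sum of the powers.\<close>
    have "cmod (f x + g x) \<le> max (cmod (2 * f x)) (cmod (2 * g x))"
      using norm_triangle_ineq[of "f x" "g x"] by (simp add: norm_mult)
    then have "cmod (f x + g x) powr ?q \<le> max (cmod (2 * f x)) (cmod (2 * g x)) powr ?q"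
      by (intro powr_mono2) auto
    then show ?thesis
      by (auto simp: max_def split: if_splits intro: order_trans)
  qed
  have "integrable M (\<lambda>x. cmod (f x + g x) powr ?q)"
    by (rule Bochner_Integration.integrable_bound[OF int]) (auto intro!: AE_I2 order_trans[OF bound])
  then show ?thesis using False by (simp add: Lp_fun_def)
qed

lemma Lp_norm_zero: "Lp_norm M p (\<lambda>x. 0) = 0"
proof (cases "p = \<infinity>")
  case True
  have "esssup M (\<lambda>x. 0 :: ennreal) \<le> 0" by (intro esssup_I) auto
  then show ?thesis using True by (simp add: Lp_norm_def)
qed (simp add: Lp_norm_def)

text \<open>
  The weight \<open>w\<close> lies in \<open>L\<^sup>1\<close> and in \<open>L\<^sup>\<infinity>\<close>. For finite \<open>p\<close> the elementary inequality
  \<open>t \<le> 1 + t\<^sup>p\<close> gives \<open>|f w| \<le> |w| + C |f|\<^sup>p\<close>.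
\<close>

lemma Lp_fun_mult_integrable:
  assumes p: "1 \<le> p" and f: "f \<in> Lp_fun M p"
    and w1: "integrable M (\<lambda>x. cmod (w x))" and w2: "AE x in M. cmod (w x) \<le> C"
    and w: "w \<in> borel_measurable M"
  shows "integrable M (\<lambda>x. f x * w x)"
proof (cases "p = \<infinity>")
  case True
  obtain D where D: "AE x in M. cmod (f x) \<le> D"
    using f by (auto simp: Lp_fun_infinity_iff[OF True])
  show ?thesis
  proof (rule Bochner_Integration.integrable_bound)
    show "integrable M (\<lambda>x. D * cmod (w x))" using w1 by simp
    show "AE x in M. norm (f x * w x) \<le> norm (D * cmod (w x))"
      using D
      by eventually_elim
         (auto simp: norm_mult abs_mult intro!: mult_right_mono)
  qed (use Lp_fun_measurable[OF f] w in simp)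
next
  case False
  let ?q = "enn2real p"
  have q: "?q \<ge> 1" using enn2real_exponent_ge_1[OF p False] .
  show ?thesis
  proof (rule Bochner_Integration.integrable_bound)
    show "integrable M (\<lambda>x. cmod (w x) + C * cmod (f x) powr ?q)"
      using w1 f False by (simp add: Lp_fun_def)
    show "AE x in M. norm (f x * w x) \<le> norm (cmod (w x) + C * cmod (f x) powr ?q)"
      using w2
    proof eventually_elim
      case (elim x)
      have "cmod (f x) \<le> 1 + cmod (f x) powr ?q"
      proof (cases "cmod (f x) \<le> 1")
        case False
        then have "cmod (f x) powr 1 \<le> cmod (f x) powr ?q" using q by (intro powr_mono) auto
        then show ?thesis using False by simp
      qed (simp add: add_increasing2)
      then have "cmod (f x) * cmod (w x) \<le> (1 + cmod (f x) powr ?q) * cmod (w x)"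
        by (intro mult_right_mono) auto
      also have "\<dots> \<le> cmod (w x) + C * cmod (f x) powr ?q"
        using mult_right_mono[OF elim, of "cmod (f x) powr ?q"] by (simp add: algebra_simps)
      finally show ?case by (simp add: norm_mult)
    qed
  qed (use Lp_fun_measurable[OF f] w in simp)
qed

text \<open>
  The graph of \<open>t \<mapsto> t\<^sup>q\<close> lies above its tangent at \<open>c\<close>; this is Young's inequality for
  \<open>t\<^sup>q\<close> and \<open>c\<^sup>q\<close> with weights \<open>1/q\<close> and \<open>1 - 1/q\<close>.
\<close>

lemma powr_tangent_line:
  fixes c t q :: real
  assumes "c > 0" "t \<ge> 0" "q \<ge> 1"
  shows "q * c powr (q - 1) * t \<le> t powr q + (q - 1) * c powr q"
proof (cases "t = 0")
  case False
  then have "t > 0" using assms by simp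
  have "(t powr q) powr (1 / q) * (c powr q) powr (1 - 1 / q) \<le>
      1 / q * t powr q + (1 - 1 / q) * c powr q"
    using assms \<open>t > 0\<close> by (intro Youngs_inequality_0) auto
  also have "(t powr q) powr (1 / q) = t" using \<open>t > 0\<close> assms by (simp add: powr_powr)
  also have "(c powr q) powr (1 - 1 / q) = c powr (q - 1)"
    using assms by (simp add: powr_powr algebra_simps)
  finally have "q * (t * c powr (q - 1)) \<le> q * (1 / q * t powr q + (1 - 1 / q) * c powr q)"
    using assms by (intro mult_left_mono) auto
  also have "\<dots> = t powr q + (q - 1) * c powr q"
    using assms by (simp add: field_simps)
  finally show ?thesis by (simp add: mult_ac)
qed (use assms in simp)

text \<open>
  Jensen's inequality for the measure \<open>k dM\<close> of mass at most \<open>A\<close>. Integrating the tangent line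
  inequality against \<open>k\<close> yields \<open>q c\<^sup>q\<^sup>-\<^sup>1 I \<le> J + (q - 1) c\<^sup>q A\<close> for all \<open>c > 0\<close>. The value \<open>c = 1\<close>
  shows that \<open>I\<close> is finite, and \<open>c = I / A\<close> gives the sharp bound.
\<close>

lemma weighted_power_mean:
  fixes f :: "'a \<Rightarrow> real" and k :: "'a \<Rightarrow> ennreal"
  assumes [measurable]: "k \<in> borel_measurable M" "f \<in> borel_measurable M"
    and f: "\<And>x. 0 \<le> f x" and q: "q \<ge> 1" and A: "A > 0"
    and k: "(\<integral>\<^sup>+x. k x \<partial>M) \<le> ennreal A"
    and J: "(\<integral>\<^sup>+x. k x * ennreal (f x powr q) \<partial>M) < \<infinity>"
  shows "(\<integral>\<^sup>+x. k x * ennreal (f x) \<partial>M) < \<infinity>"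
    and "ennreal (enn2real (\<integral>\<^sup>+x. k x * ennreal (f x) \<partial>M) powr q) \<le>
           ennreal (A powr (q - 1)) * (\<integral>\<^sup>+x. k x * ennreal (f x powr q) \<partial>M)"
proof -
  define I where "I = (\<integral>\<^sup>+x. k x * ennreal (f x) \<partial>M)"
  define J where "J = (\<integral>\<^sup>+x. k x * ennreal (f x powr q) \<partial>M)"
  have tangent: "ennreal (q * c powr (q - 1)) * I \<le> J + ennreal ((q - 1) * c powr q * A)" if "c > 0" for c
  proof -
    have "ennreal (q * c powr (q - 1)) * I = (\<integral>\<^sup>+x. k x * ennreal (q * c powr (q - 1) * f x) \<partial>M)"
      using q f unfolding I_def
      by (subst nn_integral_cmult[symmetric]) (auto simp: ennreal_mult mult_ac)
    also have "\<dots> \<le> (\<integral>\<^sup>+x. k x * ennreal (f x powr q) + ennreal ((q - 1) * c powr q) * k x \<partial>M)"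
    proof (rule nn_integral_mono)
      fix x
      have "k x * ennreal (q * c powr (q - 1) * f x) \<le> k x * ennreal (f x powr q + (q - 1) * c powr q)"
        using powr_tangent_line[OF that f q] by (intro mult_left_mono ennreal_leI) auto
      also have "\<dots> = k x * ennreal (f x powr q) + ennreal ((q - 1) * c powr q) * k x"
        using q by (simp add: distrib_left mult.commute)
      finally show "k x * ennreal (q * c powr (q - 1) * f x) \<le> \<dots>" .
    qed
    also have "\<dots> = J + ennreal ((q - 1) * c powr q) * (\<integral>\<^sup>+x. k x \<partial>M)"
      by (simp add: nn_integral_add nn_integral_cmult J_def)
    also have "\<dots> \<le> J + ennreal ((q - 1) * c powr q) * ennreal A"
      by (intro add_left_mono mult_left_mono k) auto
    also have "\<dots> = J + ennreal ((q - 1) * c powr q * A)"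
      using q A by (simp add: ennreal_mult)
    finally show ?thesis .
  qed
  have "J < \<infinity>" using J by (simp add: J_def)
  have "ennreal q * I < \<infinity>"
    by (rule le_less_trans[of _ "J + ennreal ((q - 1) * A)"]) (use tangent[of 1] \<open>J < \<infinity>\<close> in simp_all)
  then have "I < \<infinity>" using q by (auto simp: ennreal_mult_less_top)
  then show "(\<integral>\<^sup>+x. k x * ennreal (f x) \<partial>M) < \<infinity>" by (simp add: I_def)
  obtain i where i: "I = ennreal i" "i \<ge> 0" using \<open>I < \<infinity>\<close> by (cases I) auto
  obtain j where j: "J = ennreal j" "j \<ge> 0" using \<open>J < \<infinity>\<close> by (cases J) auto
  have "i powr q \<le> A powr (q - 1) * j"
  proof (cases "i = 0")
    case False
    \<comment> \<open>The tangent point \<open>i / A\<close> is the mean of \<open>f\<close>, where Jensen's inequality is sharpest.\<close>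
    define c where "c = i / A"
    have c: "c > 0" "i = c * A" using False i A by (auto simp: c_def)
    have "ennreal (q * c powr (q - 1) * i) \<le> ennreal (j + (q - 1) * c powr q * A)"
      using tangent[OF c(1)] i j q A by (simp add: ennreal_mult)
    then have "q * c powr (q - 1) * i \<le> j + (q - 1) * c powr q * A"
      using j q A by (subst (asm) ennreal_le_iff) auto
    moreover have "q * c powr (q - 1) * i = q * (c powr q * A)"
      using c by (simp add: powr_diff)
    moreover have "(q - 1) * c powr q * A = q * (c powr q * A) - c powr q * A"
      by (simp add: algebra_simps)
    ultimately have "c powr q * A \<le> j" by linarith
    then have "A powr (q - 1) * (c powr q * A) \<le> A powr (q - 1) * j"
      by (intro mult_left_mono) auto
    moreover have "i powr q = A powr (q - 1) * (c powr q * A)"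
      using c A by (simp add: powr_mult powr_diff)
    ultimately show ?thesis by simp
  qed (use j in simp)
  then show "ennreal (enn2real (\<integral>\<^sup>+x. k x * ennreal (f x) \<partial>M) powr q) \<le>
           ennreal (A powr (q - 1)) * (\<integral>\<^sup>+x. k x * ennreal (f x powr q) \<partial>M)"
    unfolding I_def[symmetric] J_def[symmetric] i(1) j(1)
    using i j by (simp add: ennreal_mult'[symmetric] ennreal_leI)
qed

text \<open>
  For finite \<open>p\<close>, Jensen's inequality in \<open>w\<close> contributes \<open>A\<^sup>p\<^sup>-\<^sup>1\<close> through the row bound, and
  Tonelli's theorem contributes \<open>A\<close> through the column bound; for \<open>p = \<infinity>\<close> the row bound is the
  operator bound. The second conclusion is about any \<open>h\<close> dominated by the positive operator with kernel
  \<open>k\<close>, so it applies to iterated integrals that are not written as an integral against \<open>f\<close>.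
\<close>

lemma schur_test:
  fixes f h :: "'a \<Rightarrow> complex" and k :: "'a \<Rightarrow> 'a \<Rightarrow> ennreal"
  assumes M: "sigma_finite_measure M"
    and k [measurable]: "(\<lambda>(y, w). k y w) \<in> borel_measurable (M \<Otimes>\<^sub>M M)"
    and A: "A > 0"
    and row: "AE y in M. (\<integral>\<^sup>+w. k y w \<partial>M) \<le> ennreal A"
    and col: "AE w in M. (\<integral>\<^sup>+y. k y w \<partial>M) \<le> ennreal A"
    and p: "1 \<le> p" and f: "f \<in> Lp_fun M p"
  shows "AE y in M. (\<integral>\<^sup>+w. k y w * ennreal (cmod (f w)) \<partial>M) < \<infinity>"
    and "h \<in> borel_measurable M \<Longrightarrow>
         AE y in M. ennreal (cmod (h y)) \<le> (\<integral>\<^sup>+w. k y w * ennreal (cmod (f w)) \<partial>M) \<Longrightarrow>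
         h \<in> Lp_fun M p \<and> Lp_norm M p h \<le> A * Lp_norm M p f"
proof -
  interpret sigma_finite_measure M by fact
  interpret P: pair_sigma_finite M M ..
  have [measurable]: "f \<in> borel_measurable M" by (rule Lp_fun_measurable[OF f])
  define F where "F y = (\<integral>\<^sup>+w. k y w * ennreal (cmod (f w)) \<partial>M)" for y
  have [measurable]: "F \<in> borel_measurable M" unfolding F_def by measurable
  have "(AE y in M. F y < \<infinity>) \<and> (h \<in> borel_measurable M \<longrightarrow> (AE y in M. ennreal (cmod (h y)) \<le> F y) \<longrightarrow>
          h \<in> Lp_fun M p \<and> Lp_norm M p h \<le> A * Lp_norm M p f)"
  proof (cases "p = \<infinity>")
    case True
    define B where "B = Lp_norm M p f"
    have "B \<ge> 0" by (simp add: B_def Lp_norm_nonneg)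
    have fB: "AE w in M. cmod (f w) \<le> B"
      using AE_le_Lp_norm_infinity f True by (simp add: B_def)
    have FB: "AE y in M. F y \<le> ennreal (A * B)"
      using row AE_space
    proof eventually_elim
      case (elim y)
      have [measurable]: "k y \<in> borel_measurable M"
        using measurable_Pair2[OF k, of y] elim by simp
      have "F y \<le> (\<integral>\<^sup>+w. k y w * ennreal B \<partial>M)"
        unfolding F_def
        by (rule nn_integral_mono_AE, use fB in eventually_elim) (auto intro!: mult_left_mono ennreal_leI)
      also have "\<dots> = (\<integral>\<^sup>+w. k y w \<partial>M) * ennreal B"
        by (rule nn_integral_multc) measurable
      also have "\<dots> \<le> ennreal A * ennreal B"
        using elim by (intro mult_right_mono) auto
      finally show ?case using A \<open>B \<ge> 0\<close> by (simp add: ennreal_mult)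
    qed
    have "h \<in> Lp_fun M p \<and> Lp_norm M p h \<le> A * B"
      if h: "h \<in> borel_measurable M" "AE y in M. ennreal (cmod (h y)) \<le> F y"
    proof -
      have "AE y in M. ennreal (cmod (h y)) \<le> ennreal (A * B)"
        using h(2) FB by eventually_elim (rule order_trans)
      then have le: "esssup M (\<lambda>y. ennreal (cmod (h y))) \<le> ennreal (A * B)"
        using h(1) by (intro esssup_I) auto
      then have "Lp_norm M p h \<le> A * B"
        using True enn2real_mono[OF le] A \<open>B \<ge> 0\<close> by (simp add: Lp_norm_def)
      moreover have "h \<in> Lp_fun M p"
        using True h(1) le_less_trans[OF le] by (simp add: Lp_fun_def)
      ultimately show ?thesis by simp
    qed
    moreover have "AE y in M. F y < \<infinity>"
      using FB by eventually_elim (auto intro: le_less_trans)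
    ultimately show ?thesis by (auto simp: B_def)
  next
    case False
    define q where "q = enn2real p"
    have q: "q \<ge> 1" using enn2real_exponent_ge_1[OF p False] by (simp add: q_def)
    define S where "S = (\<integral>\<^sup>+w. ennreal (cmod (f w) powr q) \<partial>M)"
    define G where "G y = (\<integral>\<^sup>+w. k y w * ennreal (cmod (f w) powr q) \<partial>M)" for y
    have [measurable]: "G \<in> borel_measurable M" unfolding G_def by measurable
    have "S < \<infinity>" using f False by (simp add: Lp_fun_finite_iff S_def q_def)
    have "(\<integral>\<^sup>+y. G y \<partial>M) = (\<integral>\<^sup>+w. (\<integral>\<^sup>+y. k y w * ennreal (cmod (f w) powr q) \<partial>M) \<partial>M)"
      unfolding G_def by (rule P.Fubini') measurable
    also have "\<dots> = (\<integral>\<^sup>+w. (\<integral>\<^sup>+y. k y w \<partial>M) * ennreal (cmod (f w) powr q) \<partial>M)"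
      by (intro nn_integral_cong nn_integral_multc) measurable
    also have "\<dots> \<le> (\<integral>\<^sup>+w. ennreal A * ennreal (cmod (f w) powr q) \<partial>M)"
      by (rule nn_integral_mono_AE, use col in eventually_elim) (auto intro!: mult_right_mono)
    also have "\<dots> = ennreal A * S" by (simp add: nn_integral_cmult S_def)
    finally have GS: "(\<integral>\<^sup>+y. G y \<partial>M) \<le> ennreal A * S" .
    then have "(\<integral>\<^sup>+y. G y \<partial>M) < \<infinity>"
      using \<open>S < \<infinity>\<close> by (auto intro: le_less_trans simp: ennreal_mult_less_top)
    then have "AE y in M. G y \<noteq> \<infinity>" by (intro nn_integral_PInf_AE) auto
    then have FG: "AE y in M. F y < \<infinity> \<and> ennreal (enn2real (F y) powr q) \<le> ennreal (A powr (q - 1)) * G y"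
      using row AE_space
    proof eventually_elim
      case (elim y)
      have [measurable]: "k y \<in> borel_measurable M"
        using measurable_Pair2[OF k, of y] elim by simp
      have "G y < \<infinity>" using elim by (simp add: less_top)
      then show ?case
        using weighted_power_mean[of "k y" M "\<lambda>w. cmod (f w)" q A] q A elim
        unfolding F_def G_def by simp
    qed
    have "h \<in> Lp_fun M p \<and> Lp_norm M p h \<le> A * Lp_norm M p f"
      if h: "h \<in> borel_measurable M" "AE y in M. ennreal (cmod (h y)) \<le> F y"
    proof -
      note [measurable] = h(1)
      have "(\<integral>\<^sup>+y. ennreal (cmod (h y) powr q) \<partial>M) \<le> (\<integral>\<^sup>+y. ennreal (A powr (q - 1)) * G y \<partial>M)"
      proof (rule nn_integral_mono_AE, use h(2) FG in eventually_elim)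
        case (elim y)
        then have "cmod (h y) \<le> enn2real (F y)"
          using enn2real_mono[OF elim(1)] by simp
        then have "ennreal (cmod (h y) powr q) \<le> ennreal (enn2real (F y) powr q)"
          using q by (intro ennreal_leI powr_mono2) auto
        also have "\<dots> \<le> ennreal (A powr (q - 1)) * G y" using elim by simp
        finally show ?case .
      qed
      also have "\<dots> = ennreal (A powr (q - 1)) * (\<integral>\<^sup>+y. G y \<partial>M)"
        by (simp add: nn_integral_cmult)
      also have "\<dots> \<le> ennreal (A powr (q - 1)) * (ennreal A * S)"
        by (intro mult_left_mono GS) auto
      also have "\<dots> = ennreal (A powr q) * S"
        using A by (simp add: mult.assoc[symmetric] ennreal_mult'[symmetric] powr_diff)
      finally have hS: "(\<integral>\<^sup>+y. ennreal (cmod (h y) powr q) \<partial>M) \<le> ennreal (A powr q) * S" .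
      also have "\<dots> < \<infinity>" using \<open>S < \<infinity>\<close> by (simp add: ennreal_mult_less_top)
      finally have hL: "h \<in> Lp_fun M p" using False h(1) by (simp add: Lp_fun_finite_iff q_def)
      have S: "S = ennreal (\<integral>w. cmod (f w) powr q \<partial>M)"
        using f False unfolding S_def by (intro nn_integral_eq_integral) (auto simp: Lp_fun_def q_def)
      have "ennreal (\<integral>y. cmod (h y) powr q \<partial>M) = (\<integral>\<^sup>+y. ennreal (cmod (h y) powr q) \<partial>M)"
        using hL False by (intro nn_integral_eq_integral[symmetric]) (auto simp: Lp_fun_def q_def)
      also have "\<dots> \<le> ennreal (A powr q * (\<integral>w. cmod (f w) powr q \<partial>M))"
        using hS by (simp add: S ennreal_mult')
      finally have "(\<integral>y. cmod (h y) powr q \<partial>M) \<le> A powr q * (\<integral>w. cmod (f w) powr q \<partial>M)"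
        by (simp add: ennreal_le_iff)
      then have "(\<integral>y. cmod (h y) powr q \<partial>M) powr (1 / q) \<le> (A powr q * (\<integral>w. cmod (f w) powr q \<partial>M)) powr (1 / q)"
        using q by (intro powr_mono2) auto
      also have "\<dots> = A * (\<integral>w. cmod (f w) powr q \<partial>M) powr (1 / q)"
        using q A by (simp add: powr_mult powr_powr)
      finally show ?thesis using hL False by (simp add: Lp_norm_def q_def)
    qed
    moreover have "AE y in M. F y < \<infinity>"
      using FG by eventually_elim simp
    ultimately show ?thesis by blast
  qed
  then show "AE y in M. (\<integral>\<^sup>+w. k y w * ennreal (cmod (f w)) \<partial>M) < \<infinity>"
    and "h \<in> borel_measurable M \<Longrightarrow>
         AE y in M. ennreal (cmod (h y)) \<le> (\<integral>\<^sup>+w. k y w * ennreal (cmod (f w)) \<partial>M) \<Longrightarrow>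
         h \<in> Lp_fun M p \<and> Lp_norm M p h \<le> A * Lp_norm M p f"
    unfolding F_def by auto
qed


section \<open>Superpositions of rank-one operators\<close>

lemma borel_measurable_cnj [measurable]: "cnj \<in> borel_measurable borel"
  by (intro borel_measurable_continuous_onI continuous_intros)

text \<open>
  Both marginals of the kernel \<open>\<integral> s(z) b(z,y) a(z,w) dz\<close> are bounded by this lemma, with the roles of
  \<open>a\<close> and \<open>b\<close> exchanged for the second one. For each \<open>z\<close> the hypothesis holds for almost every \<open>y\<close>;
  the quantifiers are exchanged by Fubini's theorem for null sets.
\<close>

lemma AE_composed_kernel_le:
  fixes s :: "'z \<Rightarrow> ennreal" and a b :: "'z \<Rightarrow> 'y \<Rightarrow> ennreal"
  assumes M: "sigma_finite_measure M" and N: "sigma_finite_measure N"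
    and [measurable]: "s \<in> borel_measurable N"
    and a [measurable]: "(\<lambda>(z, w). a z w) \<in> borel_measurable (N \<Otimes>\<^sub>M M)"
    and b [measurable]: "(\<lambda>(z, y). b z y) \<in> borel_measurable (N \<Otimes>\<^sub>M M)"
    and bound: "\<And>z. z \<in> space N \<Longrightarrow> AE y in M. b z y * (\<integral>\<^sup>+w. a z w \<partial>M) \<le> P"
  shows "AE y in M. (\<integral>\<^sup>+w. (\<integral>\<^sup>+z. s z * b z y * a z w \<partial>N) \<partial>M) \<le> P * (\<integral>\<^sup>+z. s z \<partial>N)"
proof -
  interpret M: sigma_finite_measure M by fact
  interpret N: sigma_finite_measure N by fact
  interpret NM: pair_sigma_finite N M ..
  have "AE z in N. AE y in M. b z y * (\<integral>\<^sup>+w. a z w \<partial>M) \<le> P"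
    using bound by (rule AE_I2)
  then have "AE y in M. AE z in N. b z y * (\<integral>\<^sup>+w. a z w \<partial>M) \<le> P"
    by (subst (asm) NM.AE_commute) measurable
  then show ?thesis
    using AE_space
  proof eventually_elim
    case (elim y)
    note y [measurable] = \<open>y \<in> space M\<close>
    have by_meas [measurable]: "(\<lambda>z. b z y) \<in> borel_measurable N"
      using measurable_Pair1[OF b y] by simp
    have az: "a z \<in> borel_measurable M" if "z \<in> space N" for z
      using measurable_Pair2[OF a that] by simp
    have "(\<integral>\<^sup>+w. (\<integral>\<^sup>+z. s z * b z y * a z w \<partial>N) \<partial>M) = (\<integral>\<^sup>+z. (\<integral>\<^sup>+w. s z * b z y * a z w \<partial>M) \<partial>N)"
      by (rule NM.Fubini') measurable
    also have "\<dots> = (\<integral>\<^sup>+z. s z * (b z y * (\<integral>\<^sup>+w. a z w \<partial>M)) \<partial>N)"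
      by (intro nn_integral_cong) (simp add: nn_integral_cmult az mult.assoc)
    also have "\<dots> \<le> (\<integral>\<^sup>+z. s z * P \<partial>N)"
      by (rule nn_integral_mono_AE, use elim(1) in eventually_elim) (rule mult_left_mono, auto)
    also have "\<dots> = P * (\<integral>\<^sup>+z. s z \<partial>N)"
      by (simp add: nn_integral_multc mult.commute[of P])
    finally show ?case .
  qed
qed

text \<open>
  Boundedness of superpositions of rank-one operators: Schur's test for the kernel
  \<open>k(y,w) = \<integral> |s(z)| |v(z,y)| |u(z,w)| dz\<close>. The test needs a positive constant and
  \<open>P \<parallel>s\<parallel>\<^sub>1\<close> may be \<open>0\<close>, so every larger constant is used and the bound follows in the limit.
\<close>

lemma kernel_superposition_bounded:
  fixes s :: "'z \<Rightarrow> complex" and u v :: "'z \<Rightarrow> 'y \<Rightarrow> complex" and f :: "'y \<Rightarrow> complex"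
  assumes M: "sigma_finite_measure M" and N: "sigma_finite_measure N"
    and s: "s \<in> Lp_fun N 1"
    and u [measurable]: "(\<lambda>(z, w). u z w) \<in> borel_measurable (N \<Otimes>\<^sub>M M)"
    and v [measurable]: "(\<lambda>(z, y). v z y) \<in> borel_measurable (N \<Otimes>\<^sub>M M)"
    and row: "\<And>z. z \<in> space N \<Longrightarrow>
      AE y in M. ennreal (cmod (v z y)) * (\<integral>\<^sup>+w. ennreal (cmod (u z w)) \<partial>M) \<le> ennreal P"
    and col: "\<And>z. z \<in> space N \<Longrightarrow>
      AE w in M. ennreal (cmod (u z w)) * (\<integral>\<^sup>+y. ennreal (cmod (v z y)) \<partial>M) \<le> ennreal P"
    and P: "0 \<le> P" and p: "1 \<le> p" and f: "f \<in> Lp_fun M p"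
  defines "K \<equiv> \<lambda>y z. s z * (\<integral>w. f w * cnj (u z w) \<partial>M) * v z y"
  shows "AE y in M. integrable N (K y)"
    and "(\<lambda>y. \<integral>z. K y z \<partial>N) \<in> Lp_fun M p"
    and "Lp_norm M p (\<lambda>y. \<integral>z. K y z \<partial>N) \<le> P * Lp_norm N 1 s * Lp_norm M p f"
proof -
  interpret M: sigma_finite_measure M by fact
  interpret N: sigma_finite_measure N by fact
  interpret NM: pair_sigma_finite N M ..
  have [measurable]: "f \<in> borel_measurable M" "s \<in> borel_measurable N"
    using f s by (auto intro: Lp_fun_measurable)
  define S where "S = Lp_norm N 1 s"
  have S: "(\<integral>\<^sup>+z. ennreal (cmod (s z)) \<partial>N) = ennreal S"
    unfolding S_def by (rule nn_integral_eq_Lp_norm_1[OF s])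
  have "S \<ge> 0" by (simp add: S_def Lp_norm_nonneg)
  define k where "k y w = (\<integral>\<^sup>+z. ennreal (cmod (s z)) * ennreal (cmod (v z y)) * ennreal (cmod (u z w)) \<partial>N)" for y w
  define F where "F y = (\<integral>\<^sup>+w. k y w * ennreal (cmod (f w)) \<partial>M)" for y
  define h where "h y = (\<integral>z. K y z \<partial>N)" for y
  have vy [measurable]: "(\<lambda>z. v z y) \<in> borel_measurable N" if "y \<in> space M" for y
    using measurable_Pair1[OF v that] by simp
  have k [measurable]: "(\<lambda>(y, w). k y w) \<in> borel_measurable (M \<Otimes>\<^sub>M M)"
    unfolding k_def by measurable
  have [measurable (raw)]: "(\<lambda>x. u (i x) (j x)) \<in> borel_measurable R" "(\<lambda>x. v (i x) (j x)) \<in> borel_measurable R"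
    if "i \<in> R \<rightarrow>\<^sub>M N" "j \<in> R \<rightarrow>\<^sub>M M" for R :: "'r measure" and i j
    using measurable_compose[OF measurable_Pair[OF that] u] measurable_compose[OF measurable_Pair[OF that] v]
    by simp_all
  have "case_prod K \<in> borel_measurable (M \<Otimes>\<^sub>M N)"
    unfolding K_def by measurable
  then have [measurable]: "h \<in> borel_measurable M"
    unfolding h_def by measurable
  have Ky [measurable]: "K y \<in> borel_measurable N" if "y \<in> space M" for y
    using measurable_Pair2[OF \<open>case_prod K \<in> _\<close> that] by simp
  have rowk: "AE y in M. (\<integral>\<^sup>+w. k y w \<partial>M) \<le> ennreal (P * S)"
    using AE_composed_kernel_le[OF M N, of "\<lambda>z. ennreal (cmod (s z))" "\<lambda>z w. ennreal (cmod (u z w))"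
        "\<lambda>z y. ennreal (cmod (v z y))" "ennreal P"] row P \<open>S \<ge> 0\<close>
    by (simp add: k_def S ennreal_mult)
  have colk: "AE w in M. (\<integral>\<^sup>+y. k y w \<partial>M) \<le> ennreal (P * S)"
    using AE_composed_kernel_le[OF M N, of "\<lambda>z. ennreal (cmod (s z))" "\<lambda>z w. ennreal (cmod (v z w))"
        "\<lambda>z y. ennreal (cmod (u z y))" "ennreal P"] col P \<open>S \<ge> 0\<close>
    by (simp add: k_def S ennreal_mult mult_ac)
  have KF: "(\<integral>\<^sup>+z. ennreal (cmod (K y z)) \<partial>N) \<le> F y" if y: "y \<in> space M" for y
  proof -
    note [measurable] = vy[OF y]
    have uz: "u z \<in> borel_measurable M" if "z \<in> space N" for z
      using measurable_Pair2[OF u that] by simp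
    have "(\<integral>\<^sup>+z. ennreal (cmod (K y z)) \<partial>N) \<le>
        (\<integral>\<^sup>+z. (\<integral>\<^sup>+w. ennreal (cmod (s z)) * ennreal (cmod (v z y)) * ennreal (cmod (u z w)) * ennreal (cmod (f w)) \<partial>M) \<partial>N)"
    proof (rule nn_integral_mono)
      fix z assume z: "z \<in> space N"
      note [measurable] = uz[OF z]
      have "ennreal (cmod (\<integral>w. f w * cnj (u z w) \<partial>M)) \<le> (\<integral>\<^sup>+w. ennreal (cmod (f w * cnj (u z w))) \<partial>M)"
        by (cases "integrable M (\<lambda>w. f w * cnj (u z w))")
           (auto simp: not_integrable_integral_eq intro: integral_norm_bound_ennreal)
      then have "ennreal (cmod (K y z)) \<le> ennreal (cmod (s z)) * ennreal (cmod (v z y)) *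
          (\<integral>\<^sup>+w. ennreal (cmod (f w * cnj (u z w))) \<partial>M)"
        by (simp add: K_def norm_mult ennreal_mult mult_ac mult_left_mono)
      also have "\<dots> = (\<integral>\<^sup>+w. ennreal (cmod (s z)) * ennreal (cmod (v z y)) * ennreal (cmod (u z w)) * ennreal (cmod (f w)) \<partial>M)"
        by (subst nn_integral_cmult[symmetric]) (auto simp: norm_mult ennreal_mult mult_ac)
      finally show "ennreal (cmod (K y z)) \<le> \<dots>" .
    qed
    also have "\<dots> = (\<integral>\<^sup>+w. (\<integral>\<^sup>+z. ennreal (cmod (s z)) * ennreal (cmod (v z y)) * ennreal (cmod (u z w)) * ennreal (cmod (f w)) \<partial>N) \<partial>M)"
      by (rule NM.Fubini'[symmetric]) measurable
    also have "\<dots> = F y"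
      unfolding F_def k_def
      by (intro nn_integral_cong nn_integral_multc) measurable
    finally show ?thesis .
  qed
  have hF: "AE y in M. ennreal (cmod (h y)) \<le> F y"
    using AE_space
  proof eventually_elim
    case (elim y)
    have "ennreal (cmod (h y)) \<le> (\<integral>\<^sup>+z. ennreal (cmod (K y z)) \<partial>N)"
      unfolding h_def
      by (cases "integrable N (K y)") (auto simp: not_integrable_integral_eq intro: integral_norm_bound_ennreal)
    also note KF[OF elim]
    finally show ?case .
  qed
  have schur: "(AE y in M. F y < \<infinity>) \<and> h \<in> Lp_fun M p \<and> Lp_norm M p h \<le> A * Lp_norm M p f"
    if A: "A > P * S" for A
  proof -
    have "A > 0" using A P \<open>S \<ge> 0\<close> by (meson le_less_trans mult_nonneg_nonneg)
    have le: "ennreal (P * S) \<le> ennreal A" using A by (intro ennreal_leI) simp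
    have "AE y in M. (\<integral>\<^sup>+w. k y w \<partial>M) \<le> ennreal A" "AE w in M. (\<integral>\<^sup>+y. k y w \<partial>M) \<le> ennreal A"
      using rowk colk by (eventually_elim, use le in \<open>blast intro: order_trans\<close>)+
    note schur = schur_test[OF M k \<open>A > 0\<close> this p f]
    have "AE y in M. F y < \<infinity>" unfolding F_def by (rule schur(1))
    moreover have "h \<in> Lp_fun M p \<and> Lp_norm M p h \<le> A * Lp_norm M p f"
      using hF unfolding F_def by (intro schur(2)) auto
    ultimately show ?thesis by simp
  qed
  from schur[of "P * S + 1"] have "AE y in M. F y < \<infinity>" by simp
  then show "AE y in M. integrable N (K y)"
    using AE_space
  proof eventually_elim
    case (elim y)
    then have "(\<integral>\<^sup>+z. ennreal (cmod (K y z)) \<partial>N) < \<infinity>"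
      using KF[of y] by (auto intro: le_less_trans)
    then show ?case using elim by (intro integrableI_bounded) auto
  qed
  from schur[of "P * S + 1"] have "h \<in> Lp_fun M p" by simp
  then show "(\<lambda>y. \<integral>z. K y z \<partial>N) \<in> Lp_fun M p" by (simp add: h_def[abs_def])
  have "Lp_norm M p h \<le> P * S * Lp_norm M p f"
  proof (rule field_le_epsilon)
    fix e :: real assume "e > 0"
    define d where "d = e / (Lp_norm M p f + 1)"
    have n: "Lp_norm M p f \<ge> 0" by (rule Lp_norm_nonneg)
    then have "d > 0" using \<open>e > 0\<close> by (simp add: d_def)
    then have "Lp_norm M p h \<le> (P * S + d) * Lp_norm M p f" using schur[of "P * S + d"] by simp
    also have "\<dots> \<le> P * S * Lp_norm M p f + e"
      using n \<open>e > 0\<close> by (simp add: d_def field_simps)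
    finally show "Lp_norm M p h \<le> P * S * Lp_norm M p f + e" .
  qed
  then show "Lp_norm M p (\<lambda>y. \<integral>z. K y z \<partial>N) \<le> P * Lp_norm N 1 s * Lp_norm M p f"
    by (simp add: h_def[abs_def] S_def)
qed

lemma ae_class_eqI:
  "f \<in> borel_measurable M \<Longrightarrow> g \<in> borel_measurable M \<Longrightarrow> AE x in M. f x = g x \<Longrightarrow> ae_class M f = ae_class M g"
  by (simp add: ae_class_eq_iff)

lemma operator_norm_le:
  assumes T: "\<And>u. u \<in> Lp M p \<Longrightarrow> class_norm M p (T u) \<le> C * class_norm M p u" and "0 \<le> C"
  shows "operator_norm M p T \<le> C"
  unfolding operator_norm_def
proof (rule cSup_least)
  have "ae_class M (\<lambda>x. 0) \<in> Lp M p" by (simp add: Lp_def Lp_fun_zero)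
  moreover have "class_norm M p (ae_class M (\<lambda>x. 0)) \<le> 1"
    by (simp add: class_norm_ae_class Lp_norm_zero)
  ultimately show "{class_norm M p (T u) |u. u \<in> Lp M p \<and> class_norm M p u \<le> 1} \<noteq> {}" by blast
next
  fix r assume "r \<in> {class_norm M p (T u) |u. u \<in> Lp M p \<and> class_norm M p u \<le> 1}"
  then obtain u where u: "r = class_norm M p (T u)" "u \<in> Lp M p" "class_norm M p u \<le> 1" by blast
  have "r \<le> C * class_norm M p u" using T u by simp
  also have "\<dots> \<le> C * 1" using u \<open>0 \<le> C\<close> by (intro mult_left_mono) auto
  finally show "r \<le> C" by simp
qed

text \<open>
  Passing from functions to classes: the value on a class is computed from any representative in
  the Lebesgue space. Uniqueness is immediate because every class has such a representative and
  operators are extensional.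
\<close>

lemma bounded_operator_of_function_map:
  assumes L: "\<And>f. f \<in> Lp_fun M p \<Longrightarrow> L f \<in> Lp_fun M p"
    and norm: "\<And>f. f \<in> Lp_fun M p \<Longrightarrow> Lp_norm M p (L f) \<le> C * Lp_norm M p f"
    and add: "\<And>f g. f \<in> Lp_fun M p \<Longrightarrow> g \<in> Lp_fun M p \<Longrightarrow>
      AE x in M. L (\<lambda>x. f x + g x) x = L f x + L g x"
    and scale: "\<And>c f. f \<in> Lp_fun M p \<Longrightarrow> AE x in M. L (\<lambda>x. c * f x) x = c * L f x"
    and cong: "\<And>f g. f \<in> Lp_fun M p \<Longrightarrow> g \<in> Lp_fun M p \<Longrightarrow> AE x in M. f x = g x \<Longrightarrow>
      AE x in M. L f x = L g x"
  shows "\<exists>!T. T \<in> bounded_operators M p \<and> (\<forall>f \<in> Lp_fun M p. T (ae_class M f) = ae_class M (L f))"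
proof (rule ex_ex1I)
  define T where "T = (\<lambda>u\<in>Lp M p. ae_class M (L (SOME f. f \<in> u \<and> f \<in> Lp_fun M p)))"
  have T: "T (ae_class M f) = ae_class M (L f)" if f: "f \<in> Lp_fun M p" for f
  proof -
    define g where "g = (SOME g. g \<in> ae_class M f \<and> g \<in> Lp_fun M p)"
    have "f \<in> ae_class M f \<and> f \<in> Lp_fun M p"
      using f by (simp add: ae_class_self Lp_fun_measurable)
    then have g: "g \<in> ae_class M f \<and> g \<in> Lp_fun M p"
      unfolding g_def by (rule someI[where P = "\<lambda>g. g \<in> ae_class M f \<and> g \<in> Lp_fun M p"])
    then have "AE x in M. L g x = L f x"
      using f by (intro cong) (auto simp: ae_class_def)
    then have "ae_class M (L g) = ae_class M (L f)"
      using L f g by (intro ae_class_eqI) (auto intro: Lp_fun_measurable)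
    moreover have "ae_class M f \<in> Lp M p" using f by (simp add: Lp_def)
    ultimately show ?thesis by (simp add: T_def g_def)
  qed
  have "T \<in> bounded_operators M p"
    unfolding bounded_operators_def
  proof (intro CollectI conjI ballI allI exI[of _ C])
    show "T \<in> Lp M p \<rightarrow>\<^sub>E Lp M p"
    proof (rule PiE_I)
      fix u assume "u \<in> Lp M p"
      then obtain f where "f \<in> Lp_fun M p" "u = ae_class M f" by (auto simp: Lp_def)
      then show "T u \<in> Lp M p" using T L by (auto simp: Lp_def)
    qed (simp add: T_def)
  next
    fix u v assume "u \<in> Lp M p" "v \<in> Lp M p"
    then obtain f g where f: "f \<in> Lp_fun M p" "u = ae_class M f" and g: "g \<in> Lp_fun M p" "v = ae_class M g"
      by (auto simp: Lp_def)
    have meas: "f \<in> borel_measurable M" "g \<in> borel_measurable M"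
        "L f \<in> borel_measurable M" "L g \<in> borel_measurable M"
        "L (\<lambda>x. f x + g x) \<in> borel_measurable M"
      using f g L Lp_fun_add[OF f(1) g(1)] by (auto intro: Lp_fun_measurable)
    have "T (class_add M u v) = ae_class M (L (\<lambda>x. f x + g x))"
      using f g meas T[OF Lp_fun_add[OF f(1) g(1)]] by (simp add: class_add_ae_class)
    also have "\<dots> = ae_class M (\<lambda>x. L f x + L g x)"
      using meas add[OF f(1) g(1)] by (intro ae_class_eqI) auto
    also have "\<dots> = class_add M (T u) (T v)"
      using f g meas T by (simp add: class_add_ae_class)
    finally show "T (class_add M u v) = class_add M (T u) (T v)" .
  next
    fix c u assume "u \<in> Lp M p"
    then obtain f where f: "f \<in> Lp_fun M p" "u = ae_class M f" by (auto simp: Lp_def)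
    have meas: "f \<in> borel_measurable M" "L f \<in> borel_measurable M" "L (\<lambda>x. c * f x) \<in> borel_measurable M"
      using f L Lp_fun_scale[OF f(1), of c] by (auto intro: Lp_fun_measurable)
    have "T (class_scale M c u) = ae_class M (L (\<lambda>x. c * f x))"
      using f meas T[OF Lp_fun_scale[OF f(1)]] by (simp add: class_scale_ae_class)
    also have "\<dots> = ae_class M (\<lambda>x. c * L f x)"
      using meas scale[OF f(1)] by (intro ae_class_eqI) auto
    also have "\<dots> = class_scale M c (T u)"
      using f meas T by (simp add: class_scale_ae_class)
    finally show "T (class_scale M c u) = class_scale M c (T u)" .
  next
    fix u assume "u \<in> Lp M p"
    then obtain f where f: "f \<in> Lp_fun M p" "u = ae_class M f" by (auto simp: Lp_def)
    then show "class_norm M p (T u) \<le> C * class_norm M p u"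
      using T L[OF f(1)] norm by (simp add: class_norm_ae_class Lp_fun_measurable)
  qed
  then show "\<exists>T. T \<in> bounded_operators M p \<and> (\<forall>f \<in> Lp_fun M p. T (ae_class M f) = ae_class M (L f))"
    using T by blast
next
  fix T T'
  assume T: "T \<in> bounded_operators M p \<and> (\<forall>f \<in> Lp_fun M p. T (ae_class M f) = ae_class M (L f))"
    and T': "T' \<in> bounded_operators M p \<and> (\<forall>f \<in> Lp_fun M p. T' (ae_class M f) = ae_class M (L f))"
  show "T = T'"
  proof (rule PiE_ext)
    show "T \<in> Lp M p \<rightarrow>\<^sub>E Lp M p" "T' \<in> Lp M p \<rightarrow>\<^sub>E Lp M p"
      using T T' by (auto simp: bounded_operators_def)
    show "T u = T' u" if "u \<in> Lp M p" for u
      using that T T' by (auto simp: Lp_def)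
  qed
qed


section \<open>Localization operators\<close>

lemma wavelet_measurable_slice:
  assumes "\<phi> \<in> borel_measurable (weinstein_measure \<alpha>)" "a > 0" "x \<in> half_space"
  shows "wavelet \<alpha> \<phi> a x \<in> borel_measurable (weinstein_measure \<alpha>)"
  using measurable_Pair2[OF borel_measurable_wavelet[OF assms(1)], of "(a, x)"] assms(2,3)
  by (simp add: space_scale_measure_X)

text \<open>
  The factors \<open>a\<^sup>\<kappa>\<close> of the \<open>L\<^sup>1\<close> bound and \<open>a\<^sup>-\<^sup>\<kappa>\<close> of the \<open>L\<^sup>\<infinity>\<close> bound cancel. The estimate is
  therefore uniform in \<open>(a,x)\<close>, which is why an integrable symbol suffices.
\<close>

lemma wavelet_pair_bound:
  fixes \<phi> \<psi> :: "((real ^ 'd) \<times> real) \<Rightarrow> complex"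
  assumes \<alpha>: "\<alpha> > - 1 / 2" and ax: "a > 0" "x \<in> half_space"
    and \<phi>: "\<phi> \<in> Lp_fun (weinstein_measure \<alpha>) 1" and \<psi>: "\<psi> \<in> Lp_fun (weinstein_measure \<alpha>) \<infinity>"
  shows "AE y in weinstein_measure \<alpha>. ennreal (cmod (wavelet \<alpha> \<psi> a x y)) *
           (\<integral>\<^sup>+w. ennreal (cmod (wavelet \<alpha> \<phi> a x w)) \<partial>weinstein_measure \<alpha>) \<le>
         ennreal (Lp_norm (weinstein_measure \<alpha>) 1 \<phi> * Lp_norm (weinstein_measure \<alpha>) \<infinity> \<psi>)"
proof -
  let ?W = "weinstein_measure \<alpha> :: ((real ^ 'd) \<times> real) measure"
  let ?k = "\<alpha> + 1 + real CARD('d) / 2"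
  have I: "(\<integral>\<^sup>+w. ennreal (cmod (wavelet \<alpha> \<phi> a x w)) \<partial>?W) \<le> ennreal (a powr ?k) * ennreal (Lp_norm ?W 1 \<phi>)"
    using nn_integral_wavelet_le[OF \<alpha> ax Lp_fun_measurable[OF \<phi>]] by (simp add: nn_integral_eq_Lp_norm_1[OF \<phi>])
  have "AE y in ?W. ennreal (cmod (\<psi> y)) \<le> ennreal (Lp_norm ?W \<infinity> \<psi>)"
    using AE_le_Lp_norm_infinity[OF \<psi>] by eventually_elim (rule ennreal_leI)
  from AE_wavelet_le[OF \<alpha> ax Lp_fun_measurable[OF \<psi>] this] show ?thesis
  proof eventually_elim
    case (elim y)
    have "a powr (- ?k) * a powr ?k = 1"
      using ax by (simp only: powr_add[symmetric]) simp
    then have one: "ennreal (a powr (- ?k)) * ennreal (a powr ?k) = 1"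
      by (simp only: ennreal_mult'[OF powr_ge_zero, symmetric] ennreal_1)
    have "ennreal (cmod (wavelet \<alpha> \<psi> a x y)) * (\<integral>\<^sup>+w. ennreal (cmod (wavelet \<alpha> \<phi> a x w)) \<partial>?W) \<le>
        (ennreal (a powr (- ?k)) * ennreal (Lp_norm ?W \<infinity> \<psi>)) * (ennreal (a powr ?k) * ennreal (Lp_norm ?W 1 \<phi>))"
      by (intro mult_mono elim I) auto
    also have "\<dots> = (ennreal (a powr (- ?k)) * ennreal (a powr ?k)) * ennreal (Lp_norm ?W 1 \<phi> * Lp_norm ?W \<infinity> \<psi>)"
      by (simp add: ennreal_mult Lp_norm_nonneg mult_ac)
    finally show ?case unfolding one by simp
  qed
qed

lemma wavelet_product_integrable:
  fixes \<phi> f :: "((real ^ 'd) \<times> real) \<Rightarrow> complex"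
  assumes \<alpha>: "\<alpha> > - 1 / 2" and ax: "a > 0" "x \<in> half_space"
    and \<phi>: "\<phi> \<in> Lp_fun (weinstein_measure \<alpha>) 1 \<inter> Lp_fun (weinstein_measure \<alpha>) \<infinity>"
    and p: "1 \<le> p" and f: "f \<in> Lp_fun (weinstein_measure \<alpha>) p"
  shows "integrable (weinstein_measure \<alpha>) (\<lambda>y. f y * cnj (wavelet \<alpha> \<phi> a x y))"
proof -
  let ?W = "weinstein_measure \<alpha> :: ((real ^ 'd) \<times> real) measure"
  let ?k = "\<alpha> + 1 + real CARD('d) / 2"
  have \<phi>1: "\<phi> \<in> Lp_fun ?W 1" and \<phi>i: "\<phi> \<in> Lp_fun ?W \<infinity>" using \<phi> by auto
  have [measurable]: "wavelet \<alpha> \<phi> a x \<in> borel_measurable ?W"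
    by (rule wavelet_measurable_slice[OF Lp_fun_measurable[OF \<phi>1] ax])
  have "AE y in ?W. ennreal (cmod (\<phi> y)) \<le> ennreal (Lp_norm ?W \<infinity> \<phi>)"
    using AE_le_Lp_norm_infinity[OF \<phi>i] by eventually_elim (rule ennreal_leI)
  from AE_wavelet_le[OF \<alpha> ax Lp_fun_measurable[OF \<phi>1] this]
  have bound: "AE y in ?W. cmod (wavelet \<alpha> \<phi> a x y) \<le> a powr (- ?k) * Lp_norm ?W \<infinity> \<phi>"
    by eventually_elim (simp add: ennreal_mult'[symmetric] Lp_norm_nonneg)
  have "(\<integral>\<^sup>+y. ennreal (cmod (wavelet \<alpha> \<phi> a x y)) \<partial>?W) \<le> ennreal (a powr ?k) * ennreal (Lp_norm ?W 1 \<phi>)"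
    using nn_integral_wavelet_le[OF \<alpha> ax Lp_fun_measurable[OF \<phi>1]] by (simp add: nn_integral_eq_Lp_norm_1[OF \<phi>1])
  also have "\<dots> < \<infinity>" by (simp add: ennreal_mult_less_top)
  finally have "integrable ?W (\<lambda>y. cmod (wavelet \<alpha> \<phi> a x y))"
    by (intro integrableI_bounded) auto
  then show ?thesis
    using bound by (intro Lp_fun_mult_integrable[OF p f]) auto
qed

theorem theorem3p8:
  fixes \<alpha> :: real and p :: ennreal
    and \<phi> \<psi> :: "((real ^ 'd) \<times> real) \<Rightarrow> complex"
    and \<sigma> :: "real \<times> ((real ^ 'd) \<times> real) \<Rightarrow> complex"
  assumes "\<alpha> > - 1 / 2"
    and "\<sigma> \<in> Lp_fun (scale_measure_X \<alpha>) 1"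
    and "\<phi> \<in> Lp_fun (weinstein_measure \<alpha>) 1 \<inter> Lp_fun (weinstein_measure \<alpha>) \<infinity>"
    and "\<psi> \<in> Lp_fun (weinstein_measure \<alpha>) 1 \<inter> Lp_fun (weinstein_measure \<alpha>) \<infinity>"
    and "1 \<le> p"
  shows "(\<exists>!T. T \<in> bounded_operators (weinstein_measure \<alpha>) p \<and>
               given_by_localization \<alpha> p \<phi> \<psi> \<sigma> T) \<and>
         (\<forall>T. T \<in> bounded_operators (weinstein_measure \<alpha>) p \<and>
               given_by_localization \<alpha> p \<phi> \<psi> \<sigma> T \<longrightarrow>
            operator_norm (weinstein_measure \<alpha>) p T
              \<le> max (Lp_norm (weinstein_measure \<alpha>) 1 \<phi> * Lp_norm (weinstein_measure \<alpha>) \<infinity> \<psi>)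
                    (Lp_norm (weinstein_measure \<alpha>) \<infinity> \<phi> * Lp_norm (weinstein_measure \<alpha>) 1 \<psi>)
                * Lp_norm (scale_measure_X \<alpha>) 1 \<sigma>)"
proof -
  note \<alpha> = assms(1) and \<sigma> = assms(2) and \<phi> = assms(3) and \<psi> = assms(4) and p = assms(5)
  let ?W = "weinstein_measure \<alpha> :: ((real ^ 'd) \<times> real) measure"
  let ?X = "scale_measure_X \<alpha> :: (real \<times> ((real ^ 'd) \<times> real)) measure"
  let ?L = "localization \<alpha> \<phi> \<psi> \<sigma>"
  define P where "P = max (Lp_norm ?W 1 \<phi> * Lp_norm ?W \<infinity> \<psi>) (Lp_norm ?W \<infinity> \<phi> * Lp_norm ?W 1 \<psi>)"
  define C where "C = P * Lp_norm ?X 1 \<sigma>"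
  have "P \<ge> 0" by (simp add: P_def le_max_iff_disj Lp_norm_nonneg)
  then have "C \<ge> 0" by (simp add: C_def Lp_norm_nonneg)
  have \<phi>_meas: "\<phi> \<in> borel_measurable ?W" and \<psi>_meas: "\<psi> \<in> borel_measurable ?W"
    using \<phi> \<psi> by (auto intro: Lp_fun_measurable)

  have integrable: "integrable ?W (\<lambda>y. f y * cnj (wavelet \<alpha> \<phi> a x y))"
    if "f \<in> Lp_fun ?W p" "a > 0" "x \<in> half_space" for f a x
    using wavelet_product_integrable[OF \<alpha> that(2,3) \<phi> p that(1)] .
  have integrand: "localization_integrand \<alpha> \<phi> \<psi> \<sigma> f =
      (\<lambda>y z. \<sigma> z * (\<integral>w. f w * cnj (wavelet \<alpha> \<phi> (fst z) (snd z) w) \<partial>?W) * wavelet \<alpha> \<psi> (fst z) (snd z) y)" for f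
    by (auto simp: localization_integrand_def wavelet_transform_def fun_eq_iff)
  have localization: "?L f = (\<lambda>y. \<integral>z. localization_integrand \<alpha> \<phi> \<psi> \<sigma> f y z \<partial>?X)" for f
    by (simp add: localization_def fun_eq_iff)
  have row: "AE y in ?W. ennreal (cmod (wavelet \<alpha> \<psi> (fst z) (snd z) y)) *
      (\<integral>\<^sup>+w. ennreal (cmod (wavelet \<alpha> \<phi> (fst z) (snd z) w)) \<partial>?W) \<le> ennreal P"
    if "z \<in> space ?X" for z
  proof -
    have "fst z > 0" "snd z \<in> half_space" using that by (auto simp: space_scale_measure_X)
    moreover have le: "ennreal (Lp_norm ?W 1 \<phi> * Lp_norm ?W \<infinity> \<psi>) \<le> ennreal P"
      by (intro ennreal_leI) (simp add: P_def)
    ultimately show ?thesis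
      using \<phi> \<psi> by (intro eventually_mono[OF wavelet_pair_bound[where \<phi> = \<phi> and \<psi> = \<psi>, OF \<alpha>]]) (auto elim: order_trans)
  qed
  have col: "AE w in ?W. ennreal (cmod (wavelet \<alpha> \<phi> (fst z) (snd z) w)) *
      (\<integral>\<^sup>+y. ennreal (cmod (wavelet \<alpha> \<psi> (fst z) (snd z) y)) \<partial>?W) \<le> ennreal P"
    if "z \<in> space ?X" for z
  proof -
    have "fst z > 0" "snd z \<in> half_space" using that by (auto simp: space_scale_measure_X)
    moreover have le: "ennreal (Lp_norm ?W 1 \<psi> * Lp_norm ?W \<infinity> \<phi>) \<le> ennreal P"
      by (intro ennreal_leI) (simp add: P_def mult.commute)
    ultimately show ?thesis
      using \<phi> \<psi> by (intro eventually_mono[OF wavelet_pair_bound[where \<phi> = \<psi> and \<psi> = \<phi>, OF \<alpha>]]) (auto elim: order_trans)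
  qed
  note bounded = kernel_superposition_bounded[OF sigma_finite_weinstein_measure sigma_finite_scale_measure_X \<sigma>
      borel_measurable_wavelet[OF \<phi>_meas] borel_measurable_wavelet[OF \<psi>_meas] row col \<open>P \<ge> 0\<close> p]
  have converges: "AE y in ?W. integrable ?X (localization_integrand \<alpha> \<phi> \<psi> \<sigma> f y)"
    and L: "?L f \<in> Lp_fun ?W p" and norm: "Lp_norm ?W p (?L f) \<le> C * Lp_norm ?W p f"
    if "f \<in> Lp_fun ?W p" for f
    using bounded[OF _ _ that] by (simp_all add: C_def localization integrand)

  have cong: "?L f y = ?L g y" if "f \<in> Lp_fun ?W p" "g \<in> Lp_fun ?W p" "AE w in ?W. f w = g w" for f g y
  proof -
    have [measurable]: "f \<in> borel_measurable ?W" "g \<in> borel_measurable ?W"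
      using that by (auto intro: Lp_fun_measurable)
    have "localization_integrand \<alpha> \<phi> \<psi> \<sigma> f y z = localization_integrand \<alpha> \<phi> \<psi> \<sigma> g y z"
      if z: "z \<in> space ?X" for z
    proof -
      have [measurable]: "wavelet \<alpha> \<phi> (fst z) (snd z) \<in> borel_measurable ?W"
        using z by (intro wavelet_measurable_slice \<phi>_meas) (auto simp: space_scale_measure_X)
      have "(\<integral>w. f w * cnj (wavelet \<alpha> \<phi> (fst z) (snd z) w) \<partial>?W) =
          (\<integral>w. g w * cnj (wavelet \<alpha> \<phi> (fst z) (snd z) w) \<partial>?W)"
        using \<open>AE w in ?W. f w = g w\<close> by (intro integral_cong_AE) (auto elim: eventually_mono)
      then show ?thesis by (simp add: integrand)
    qed
    then show ?thesis
      unfolding localization by (intro Bochner_Integration.integral_cong) auto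
  qed
  have add: "AE y in ?W. ?L (\<lambda>w. f w + g w) y = ?L f y + ?L g y"
    if f: "f \<in> Lp_fun ?W p" and g: "g \<in> Lp_fun ?W p" for f g
    using converges[OF f] converges[OF g]
  proof eventually_elim
    case (elim y)
    have "localization_integrand \<alpha> \<phi> \<psi> \<sigma> (\<lambda>w. f w + g w) y z =
        localization_integrand \<alpha> \<phi> \<psi> \<sigma> f y z + localization_integrand \<alpha> \<phi> \<psi> \<sigma> g y z"
      if "z \<in> space ?X" for z
      using that f g
      by (auto simp: integrand space_scale_measure_X distrib_right integrable distrib_left)
    then have "?L (\<lambda>w. f w + g w) y = (\<integral>z. localization_integrand \<alpha> \<phi> \<psi> \<sigma> f y z + localization_integrand \<alpha> \<phi> \<psi> \<sigma> g y z \<partial>?X)"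
      unfolding localization by (intro Bochner_Integration.integral_cong) auto
    then show ?case
      using elim by (simp add: localization)
  qed
  have scale: "?L (\<lambda>w. c * f w) y = c * ?L f y" for c f y
    by (simp add: localization integrand mult.assoc mult.left_commute[of _ c])

  \<comment> \<open>All integrals converge for every \<open>f\<close>, so only the values of \<open>T\<close> on classes remain to be prescribed.\<close>
  have given: "given_by_localization \<alpha> p \<phi> \<psi> \<sigma> T \<longleftrightarrow> (\<forall>f \<in> Lp_fun ?W p. T (ae_class ?W f) = ae_class ?W (?L f))" for T
    using integrable converges by (auto simp: given_by_localization_def)
  have "\<exists>!T. T \<in> bounded_operators ?W p \<and> given_by_localization \<alpha> p \<phi> \<psi> \<sigma> T"
    unfolding given
    by (rule bounded_operator_of_function_map[where C = C]) (auto simp: L norm add scale intro!: AE_I2 cong)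
  moreover have "operator_norm ?W p T \<le> C"
    if "given_by_localization \<alpha> p \<phi> \<psi> \<sigma> T" for T
  proof (rule operator_norm_le[OF _ \<open>C \<ge> 0\<close>])
    fix u assume "u \<in> Lp ?W p"
    then obtain f where f: "f \<in> Lp_fun ?W p" "u = ae_class ?W f" by (auto simp: Lp_def)
    then show "class_norm ?W p (T u) \<le> C * class_norm ?W p u"
      using that norm[OF f(1)] L[OF f(1)] by (simp add: given class_norm_ae_class Lp_fun_measurable)
  qed
  ultimately show ?thesis by (simp add: C_def P_def)
qed

end
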